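(* Let $d\geq1$, $\boldsymbol\mu\in\mathbb{S}^d$, $\rho\in(0,1)$, and let $\boldsymbol X_1,\dots,\boldsymbol X_n$ be iid $\mathrm{C}_1(\boldsymbol\mu,\rho)$. Let $\bar{\boldsymbol X}=n^{-1}\sum_{i=1}^n\boldsymbol X_i$, $$\hat{\boldsymbol\mu}_{\mathrm{MM},1}=\bar{\boldsymbol X}/\|\bar{\boldsymbol X}\|,\qquad\hat\rho_{\mathrm{MM},1}=(d+1)\|\bar{\boldsymbol X}\|.$$ Then (i) $(\hat{\boldsymbol\mu}_{\mathrm{MM},1},\hat\rho_{\mathrm{MM},1})\to(\boldsymbol\mu,\rho)$ almost surely as $n\to\infty$; and (ii) $$\sqrt n\begin{pmatrix}\hat{\boldsymbol\mu}_{\mathrm{MM},1}-\boldsymbol\mu\\ \hat\rho_{\mathrm{MM},1}-\rho\end{pmatrix}\rightsquigarrow\mathcal N_{d+2}\left(\boldsymbol0,\begin{pmatrix}\sigma^2_{\mathrm{MM},1}(\boldsymbol\mu)(\boldsymbol I_{d+1}-\boldsymbol\mu\boldsymbol\mu^\top)&\boldsymbol0\\ \boldsymbol0^\top&\sigma^2_{\mathrm{MM},1}(\rho)\end{pmatrix}\right)$$ in distribution as $n\to\infty$, where $\sigma^2_{\mathrm{MM},1}(\boldsymbol\mu)=(d+1)\rho^{-2}$ and $\sigma^2_{\mathrm{MM},1}(\rho)=d+1-\rho^2$.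
   Context: For $d\geq1$, $\mathbb{S}^d$ is the unit sphere of $\mathbb{R}^{d+1}$ with surface area measure $\sigma_d$ and total area $\omega_d=2\pi^{(d+1)/2}/\Gamma((d+1)/2)$. $\mathrm{C}_1(\boldsymbol\mu,\rho)$ is the distribution on $\mathbb{S}^d$ with density $\omega_d^{-1}\{1+\rho\,\boldsymbol x^\top\boldsymbol\mu\}$ w.r.t. $\sigma_d$. *)

theory Defs
  imports "HOL-Probability.Probability"
begin

text \<open>Surface area measure sigma_d on the unit sphere of R^(d+1) = real^'n, with CARD('n) = d+1.
  Defined as the cone measure: sigma_d(A) = (d+1) * Leb{x in open unit ball : x/|x| in A}.
  This is a measure on the Borel sets of real^'n supported on sphere 0 1.\<close>
definition sphere_surface :: "(real^'n) measure" where
  "sphere_surface = scale_measure (of_nat CARD('n))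
     (distr (density lborel (indicator (ball (0::real^'n) 1))) borel sgn)"

definition sphere_area :: "'n itself \<Rightarrow> real" where
  "sphere_area _ = 2 * pi powr (real CARD('n) / 2) / Gamma (real CARD('n) / 2)"

definition C1_dist :: "real^'n \<Rightarrow> real \<Rightarrow> (real^'n) measure" where
  "C1_dist mu rho = density sphere_surface
     (\<lambda>x. ennreal ((1 + rho * (x \<bullet> mu)) / sphere_area TYPE('n)))"

definition sample_mean :: "(nat \<Rightarrow> 'a \<Rightarrow> real^'n) \<Rightarrow> nat \<Rightarrow> 'a \<Rightarrow> real^'n" where
  "sample_mean X n \<omega> = (1 / real n) *\<^sub>R (\<Sum>i<n. X i \<omega>)"

definition mu_hat_MM1 :: "(nat \<Rightarrow> 'a \<Rightarrow> real^'n) \<Rightarrow> nat \<Rightarrow> 'a \<Rightarrow> real^'n" where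
  "mu_hat_MM1 X n \<omega> = (1 / norm (sample_mean X n \<omega>)) *\<^sub>R sample_mean X n \<omega>"

definition rho_hat_MM1 :: "(nat \<Rightarrow> 'a \<Rightarrow> real^'n) \<Rightarrow> nat \<Rightarrow> 'a \<Rightarrow> real" where
  "rho_hat_MM1 X n \<omega> = real CARD('n) * norm (sample_mean X n \<omega>)"

text \<open>Centered (possibly degenerate) multivariate normal law with covariance quadratic form Q
  (Q t = t^T Sigma t), characterized by its characteristic function.\<close>
definition centered_normal :: "('b::euclidean_space \<Rightarrow> real) \<Rightarrow> 'b measure \<Rightarrow> bool" where
  "centered_normal Q N \<longleftrightarrow> prob_space N \<and> sets N = sets borel \<and>
     (\<forall>t. (\<integral>x. cis (t \<bullet> x) \<partial>N) = complex_of_real (exp (- Q t / 2)))"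

definition conv_in_distr :: "'a measure \<Rightarrow> (nat \<Rightarrow> 'a \<Rightarrow> 'b::euclidean_space) \<Rightarrow> 'b measure \<Rightarrow> bool" where
  "conv_in_distr M Y N \<longleftrightarrow>
     (\<forall>f :: 'b \<Rightarrow> real. continuous_on UNIV f \<and> bounded (range f) \<longrightarrow>
        (\<lambda>n. \<integral>\<omega>. f (Y n \<omega>) \<partial>M) \<longlonglongrightarrow> (\<integral>x. f x \<partial>N))"

end

theory Submission
  imports Defs
begin

text \<open>
  Under \<open>C\<^sub>1(mu, rho)\<close> one has \<open>E X = (rho / (d+1)) mu\<close> and \<open>E (w \<bullet> X)\<^sup>2 = |w|\<^sup>2 / (d+1)\<close>, since odd
  moments of the uniform law vanish. Consistency is the strong law (Hoeffding and Borel-Cantelli, as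
  the sample is bounded). For normality, put \<open>y = ((d+1) / rho) X\<^sub>n\<close> with \<open>X\<^sub>n\<close> the sample mean, so that the
  estimators are \<open>sgn y\<close> and \<open>rho |y|\<close>. Both differ from their linearization at \<open>mu\<close> by at most a constant times
  \<open>|y - mu|\<^sup>2\<close>, globally in \<open>y\<close>, and \<open>E |y - mu|\<^sup>2 = O(1/n)\<close>; hence the characteristic function of the
  scaled error has the same limit as that of its linearization, which is given by the one-dimensional
  central limit theorem. Pointwise convergence of characteristic functions together with tightness
  yields convergence in distribution, because on balls continuous functions are uniform limits of
  trigonometric polynomials.
\<close>

subsection \<open>Convergence in distribution from characteristic functions\<close>

text \<open>The phase \<open>c\<close> covers sines, and \<open>t = 0\<close> gives the constants.
  Finite sums of shifted cosines thus form a real algebra of functions, as Stone-Weierstrass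
  requires.\<close>

inductive trig_poly :: "('b::real_inner \<Rightarrow> real) \<Rightarrow> bool" where
  cos: "trig_poly (\<lambda>x. a * cos (t \<bullet> x + c))"
| add: "trig_poly f \<Longrightarrow> trig_poly g \<Longrightarrow> trig_poly (\<lambda>x. f x + g x)"

lemma trig_poly_const: "trig_poly (\<lambda>_. a)"
  using trig_poly.cos[of a 0 0] by simp

text \<open>The product-to-sum formula turns each product of cosines into two shifted cosines, with
  frequencies \<open>t - s\<close> and \<open>t + s\<close>.\<close>

lemma trig_poly_mult_cos:
  assumes "trig_poly f"
  shows "trig_poly (\<lambda>x. f x * (b * cos (s \<bullet> x + d)))"
  using assms
proof induction
  case (cos a t c)
  have "(\<lambda>x. a * cos (t \<bullet> x + c) * (b * cos (s \<bullet> x + d))) =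
    (\<lambda>x. a * b / 2 * cos ((t - s) \<bullet> x + (c - d)) + a * b / 2 * cos ((t + s) \<bullet> x + (c + d)))"
  proof
    fix x
    have "cos (t \<bullet> x + c) * cos (s \<bullet> x + d) =
      (cos ((t \<bullet> x + c) - (s \<bullet> x + d)) + cos ((t \<bullet> x + c) + (s \<bullet> x + d))) / 2"
      by (rule cos_times_cos)
    also have "(t \<bullet> x + c) - (s \<bullet> x + d) = (t - s) \<bullet> x + (c - d)"
      by (simp add: inner_diff_left)
    also have "(t \<bullet> x + c) + (s \<bullet> x + d) = (t + s) \<bullet> x + (c + d)"
      by (simp add: inner_add_left)
    finally have "a * b * (cos (t \<bullet> x + c) * cos (s \<bullet> x + d)) =
        a * b * ((cos ((t - s) \<bullet> x + (c - d)) + cos ((t + s) \<bullet> x + (c + d))) / 2)"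
      by (rule arg_cong)
    then show "a * cos (t \<bullet> x + c) * (b * cos (s \<bullet> x + d)) =
      a * b / 2 * cos ((t - s) \<bullet> x + (c - d)) + a * b / 2 * cos ((t + s) \<bullet> x + (c + d))"
      by (simp only: distrib_left add_divide_distrib mult_ac times_divide_eq_right times_divide_eq_left)
  qed
  then show ?case
    by (simp only:) (intro trig_poly.intros)
next
  case (add f g)
  then show ?case
    by (simp only: distrib_right) (rule trig_poly.add)
qed

lemma trig_poly_mult:
  assumes "trig_poly f" "trig_poly g"
  shows "trig_poly (\<lambda>x. f x * g x)"
  using assms(2)
proof induction
  case (cos b s d)
  show ?case by (rule trig_poly_mult_cos[OF assms(1)])
next
  case (add g h)
  then show ?case by (simp only: distrib_left) (rule trig_poly.add)
qed

text \<open>This permits truncation within the class: a polynomial close to the clipping function is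
  composed with a trigonometric polynomial.\<close>

lemma trig_poly_polynomial_compose:
  fixes p :: "real \<Rightarrow> real"
  assumes "real_polynomial_function p" "trig_poly g"
  shows "trig_poly (\<lambda>x. p (g x))"
  using assms(1)
proof induction
  case (linear f)
  then obtain c where "f = (\<lambda>x. x * c)"
    using real_bounded_linear by blast
  then show ?case
    using trig_poly_mult[OF assms(2) trig_poly_const[of c]] by simp
qed (auto intro: trig_poly_const trig_poly.add trig_poly_mult)

lemma continuous_on_trig_poly:
  assumes "trig_poly f"
  shows "continuous_on S f"
  using assms by induction (auto intro!: continuous_intros)

lemma trig_poly_bounded:
  assumes "trig_poly f"
  obtains B where "\<And>x. \<bar>f x\<bar> \<le> B"
proof -
  have "\<exists>B. \<forall>x. \<bar>f x\<bar> \<le> B"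
    using assms
  proof induction
    case (cos a t c)
    have "\<bar>a * cos (t \<bullet> x + c)\<bar> \<le> \<bar>a\<bar>" for x
      by (simp add: abs_mult mult_left_le)
    then show ?case by blast
  next
    case (add f g)
    then obtain B C where "\<forall>x. \<bar>f x\<bar> \<le> B" "\<forall>x. \<bar>g x\<bar> \<le> C" by blast
    then have "\<bar>f x + g x\<bar> \<le> B + C" for x
      by (meson abs_triangle_ineq add_mono order_trans)
    then show ?case by blast
  qed
  then show ?thesis using that by blast
qed

lemma trig_poly_separates:
  fixes x y :: "'b::real_inner"
  assumes "x \<noteq> y"
  shows "\<exists>f. trig_poly f \<and> f x \<noteq> f y"
proof -
  \<comment> \<open>The scaling makes \<open>t \<bullet> x\<close> and \<open>t \<bullet> y\<close>
    differ by exactly 1. After subtracting the phase at \<open>y\<close>, the values to compare are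
    \<open>cos 1\<close> and \<open>cos 0\<close>.\<close>
  define t where "t = (1 / ((x - y) \<bullet> (x - y))) *\<^sub>R (x - y)"
  have "t \<bullet> x - t \<bullet> y = 1"
    using assms by (simp add: t_def flip: inner_diff_right diff_divide_distrib)
  then have "cos (t \<bullet> x + - (t \<bullet> y)) = cos 1" "cos (t \<bullet> y + - (t \<bullet> y)) = 1"
    by simp_all
  moreover have "cos (1::real) < cos 0"
    using pi_gt3 by (intro cos_monotone_0_pi) auto
  ultimately have "1 * cos (t \<bullet> x + - (t \<bullet> y)) \<noteq> 1 * cos (t \<bullet> y + - (t \<bullet> y))"
    by simp
  then show ?thesis
    using trig_poly.cos[of 1 t "- (t \<bullet> y)"] by blast
qed

text \<open>A trigonometric approximant on a ball may be huge outside of it. Truncating it keeps it bounded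
  by \<open>K\<close>, and the truncation is uniformly close to a polynomial on the bounded range of the
  approximant, so that the result is again a trigonometric polynomial.\<close>
lemma trig_poly_approx:
  fixes f :: "'b::euclidean_space \<Rightarrow> real"
  assumes cont: "continuous_on UNIV f" and K: "\<And>x. \<bar>f x\<bar> \<le> K" and "e > 0"
  obtains g where "trig_poly g" "\<And>x. norm x \<le> R \<Longrightarrow> \<bar>f x - g x\<bar> \<le> e"
    "\<And>x. \<bar>f x - g x\<bar> \<le> e + 2 * K"
proof -
  have "\<exists>g. trig_poly g \<and> (\<forall>x \<in> cball 0 R. \<bar>f x - g x\<bar> < e / 2)"
    using assms by (intro Stone_Weierstrass_HOL)
      (auto intro: trig_poly_const trig_poly.add trig_poly_mult trig_poly_separates
        continuous_on_trig_poly continuous_on_subset)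
  then obtain g where g: "trig_poly g" "\<And>x. norm x \<le> R \<Longrightarrow> \<bar>f x - g x\<bar> < e / 2"
    by auto
  obtain G where G: "\<And>x. \<bar>g x\<bar> \<le> G"
    using trig_poly_bounded[OF g(1)] by blast
  define c where "c y = max (- K) (min K y)" for y :: real
  have "continuous_on {- G..G} c"
    unfolding c_def by (intro continuous_intros)
  then obtain p where p: "real_polynomial_function p" "\<And>y. y \<in> {- G..G} \<Longrightarrow> \<bar>c y - p y\<bar> < e / 2"
    using Stone_Weierstrass_real_polynomial_function[of "{- G..G}" c "e / 2"] \<open>e > 0\<close> by auto
  have pg: "\<bar>c (g x) - p (g x)\<bar> < e / 2" for x
    using G[of x] by (intro p(2)) (auto simp: abs_le_iff)
  show ?thesis
  proof
    show "trig_poly (\<lambda>x. p (g x))"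
      by (rule trig_poly_polynomial_compose) (fact p g)+
    show "\<bar>f x - p (g x)\<bar> \<le> e" if "norm x \<le> R" for x
    proof -
      \<comment> \<open>As \<open>f\<close> takes values between \<open>- K\<close> and
        \<open>K\<close>, clipping \<open>g\<close> to that interval cannot move it away from
        \<open>f\<close>.\<close>
      have "\<bar>f x - c (g x)\<bar> \<le> \<bar>f x - g x\<bar>"
        using K[of x] unfolding c_def by linarith
      with g(2)[OF that] pg[of x] show ?thesis by linarith
    qed
    show "\<bar>f x - p (g x)\<bar> \<le> e + 2 * K" for x
      using K[of x] pg[of x] \<open>e > 0\<close> unfolding c_def by linarith
  qed
qed

text \<open>A shifted cosine is the real part of a constant times \<open>cis\<close>, so its
  integral is read off from the characteristic function. Boundedness supplies the integrability
  needed for sums.\<close>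

lemma integral_trig_poly_tendsto:
  fixes Y :: "nat \<Rightarrow> 'a \<Rightarrow> 'b::euclidean_space"
  assumes "prob_space M" "prob_space N" "sets N = sets borel"
    and [measurable]: "\<And>n. Y n \<in> borel_measurable M"
    and char: "\<And>t. (\<lambda>n. \<integral>\<omega>. cis (t \<bullet> Y n \<omega>) \<partial>M) \<longlonglongrightarrow> (\<integral>x. cis (t \<bullet> x) \<partial>N)"
    and "trig_poly g"
  shows "(\<lambda>n. \<integral>\<omega>. g (Y n \<omega>) \<partial>M) \<longlonglongrightarrow> (\<integral>x. g x \<partial>N)"
  using \<open>trig_poly g\<close>
proof induction
  case (cos a t c)
  interpret M: prob_space M by fact
  interpret N: prob_space N by fact
  note [measurable_cong] = \<open>sets N = sets borel\<close>
  have iM: "integrable M (\<lambda>\<omega>. cis (t \<bullet> Y n \<omega>))" for n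
    by (rule M.integrable_const_bound[of _ 1]) (auto simp: cis_conv_exp)
  have iN: "integrable N (\<lambda>x. cis (t \<bullet> x))"
    by (rule N.integrable_const_bound[of _ 1]) (auto simp: cis_conv_exp)
  have re: "a * cos (y + c) = Re (of_real a * cis c * cis y)" for y
    by (simp add: cos_add algebra_simps)
  have "(\<lambda>n. Re (of_real a * cis c * (\<integral>\<omega>. cis (t \<bullet> Y n \<omega>) \<partial>M)))
      \<longlonglongrightarrow> Re (of_real a * cis c * (\<integral>x. cis (t \<bullet> x) \<partial>N))"
    by (intro tendsto_intros char)
  moreover have "(\<integral>\<omega>. a * cos (t \<bullet> Y n \<omega> + c) \<partial>M) = Re (of_real a * cis c * (\<integral>\<omega>. cis (t \<bullet> Y n \<omega>) \<partial>M))" for n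
    unfolding re using iM by (subst integral_Re) auto
  moreover have "(\<integral>x. a * cos (t \<bullet> x + c) \<partial>N) = Re (of_real a * cis c * (\<integral>x. cis (t \<bullet> x) \<partial>N))"
    unfolding re using iN by (subst integral_Re) auto
  ultimately show ?case by simp
next
  case (add f g)
  interpret M: prob_space M by fact
  interpret N: prob_space N by fact
  note [measurable_cong] = \<open>sets N = sets borel\<close>
  have int: "integrable M (\<lambda>\<omega>. f (Y n \<omega>))" "integrable N f" if f: "trig_poly f" for f n
  proof -
    obtain B where "\<And>x. \<bar>f x\<bar> \<le> B" using trig_poly_bounded[OF f] by blast
    moreover have [measurable]: "f \<in> borel_measurable borel"
      using continuous_on_trig_poly[OF f] by (rule borel_measurable_continuous_onI)
    ultimately show "integrable M (\<lambda>\<omega>. f (Y n \<omega>))" "integrable N f"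
      by (auto intro!: M.integrable_const_bound[of _ B] N.integrable_const_bound[of _ B])
  qed
  show ?case
    using tendsto_add[OF add.IH] add.hyps by (simp add: int)
qed

text \<open>A multivariate form of Levy's continuity theorem in which tightness is assumed. The test
  function is replaced by a trigonometric polynomial that is close to it on a large ball; outside
  the ball the error is merely bounded, but the probability is small.\<close>

theorem conv_in_distr_charI:
  fixes Y :: "nat \<Rightarrow> 'a \<Rightarrow> 'b::euclidean_space"
  assumes "prob_space M" "prob_space N" "sets N = sets borel"
    and [measurable]: "\<And>n. Y n \<in> borel_measurable M"
    and char: "\<And>t. (\<lambda>n. \<integral>\<omega>. cis (t \<bullet> Y n \<omega>) \<partial>M) \<longlonglongrightarrow> (\<integral>x. cis (t \<bullet> x) \<partial>N)"
    and tight: "\<And>e. e > 0 \<Longrightarrow> \<exists>R. \<forall>n. measure M {\<omega> \<in> space M. R < norm (Y n \<omega>)} \<le> e"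
  shows "conv_in_distr M Y N"
  unfolding conv_in_distr_def
proof (intro allI impI)
  fix f :: "'b \<Rightarrow> real"
  assume f: "continuous_on UNIV f \<and> bounded (range f)"
  interpret M: prob_space M by fact
  interpret N: prob_space N by fact
  note [measurable_cong] = \<open>sets N = sets borel\<close>
  have [measurable]: "f \<in> borel_measurable borel"
    using f by (auto intro: borel_measurable_continuous_onI)
  obtain K where K: "\<And>x. \<bar>f x\<bar> \<le> K" "K > 0"
    using f unfolding bounded_pos by auto
  have ifM: "integrable M (\<lambda>\<omega>. f (Y n \<omega>))" for n
    using K by (auto intro!: M.integrable_const_bound[of _ K])
  have ifN: "integrable N f"
    using K by (auto intro!: N.integrable_const_bound[of _ K])
  show "(\<lambda>n. \<integral>\<omega>. f (Y n \<omega>) \<partial>M) \<longlonglongrightarrow> (\<integral>x. f x \<partial>N)"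
  proof (rule LIMSEQ_I)
    fix r :: real assume "r > 0"
    \<comment> \<open>With these constants \<open>e + 2 * K * d = r / 4\<close>. Three errors of at
      most \<open>r / 4\<close> occur: replacing \<open>f\<close> by \<open>g\<close> under
      \<open>M\<close>, the same under \<open>N\<close>, and the convergence for
      \<open>g\<close>.\<close>
    define e where "e = r / 8"
    define d where "d = r / (16 * K)"
    have "e > 0" "d > 0" using \<open>r > 0\<close> K by (auto simp: e_def d_def)
    obtain R1 where R1: "\<And>n. measure M {\<omega> \<in> space M. R1 < norm (Y n \<omega>)} \<le> d"
      using tight[OF \<open>d > 0\<close>] by blast
    \<comment> \<open>The single law \<open>N\<close> is tight, because the complements of growing
      balls decrease to the empty set.\<close>
    have "(\<lambda>k. measure N {x \<in> space N. real k < norm x}) \<longlonglongrightarrow> measure N (\<Inter>k. {x \<in> space N. real k < norm x})"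
      by (rule N.finite_Lim_measure_decseq) (auto simp: decseq_def)
    also have "(\<Inter>k. {x \<in> space N. real k < norm x}) = {}"
      using reals_Archimedean2 less_asym by (auto, blast)
    finally have "eventually (\<lambda>k. measure N {x \<in> space N. real k < norm x} < d) sequentially"
      using \<open>d > 0\<close> by (intro order_tendstoD) auto
    then obtain R2 where R2: "measure N {x \<in> space N. real R2 < norm x} < d"
      unfolding eventually_sequentially by blast
    define R where "R = max R1 (real R2)"
    have RM: "measure M {\<omega> \<in> space M. R < norm (Y n \<omega>)} \<le> d" for n
      by (rule order_trans[OF M.finite_measure_mono R1[of n]]) (auto simp: R_def)
    have RN: "measure N {x \<in> space N. R < norm x} \<le> d"
      by (rule order_trans[OF N.finite_measure_mono less_imp_le[OF R2]]) (auto simp: R_def)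
    obtain g where g: "trig_poly g" "\<And>x. norm x \<le> R \<Longrightarrow> \<bar>f x - g x\<bar> \<le> e"
      "\<And>x. \<bar>f x - g x\<bar> \<le> e + 2 * K"
      using trig_poly_approx[OF conjunct1[OF f] K(1) \<open>e > 0\<close>, of R] by blast
    have [measurable]: "g \<in> borel_measurable borel"
      using continuous_on_trig_poly[OF g(1)] by (rule borel_measurable_continuous_onI)
    \<comment> \<open>Stated for an arbitrary probability space, so that it applies both to
      \<open>Y n\<close> under \<open>M\<close> and to the identity under \<open>N\<close>.\<close>
    have close: "\<bar>(\<integral>\<omega>. f (Z \<omega>) \<partial>P) - (\<integral>\<omega>. g (Z \<omega>) \<partial>P)\<bar> \<le> e + 2 * K * d"
      if "prob_space P" and [measurable]: "Z \<in> borel_measurable P"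
        and tail: "measure P {\<omega> \<in> space P. R < norm (Z \<omega>)} \<le> d" for P :: "'c measure" and Z
    proof -
      interpret P: prob_space P by fact
      obtain B where B: "\<And>x. \<bar>g x\<bar> \<le> B" using trig_poly_bounded[OF g(1)] by blast
      have fZ: "integrable P (\<lambda>\<omega>. f (Z \<omega>))"
        using K by (auto intro!: P.integrable_const_bound[of _ K])
      have gZ: "integrable P (\<lambda>\<omega>. g (Z \<omega>))"
        using B by (auto intro!: P.integrable_const_bound[of _ B])
      let ?A = "{\<omega> \<in> space P. R < norm (Z \<omega>)}"
      have "\<bar>(\<integral>\<omega>. f (Z \<omega>) \<partial>P) - (\<integral>\<omega>. g (Z \<omega>) \<partial>P)\<bar> = \<bar>\<integral>\<omega>. f (Z \<omega>) - g (Z \<omega>) \<partial>P\<bar>"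
        using fZ gZ by simp
      also have "\<dots> \<le> (\<integral>\<omega>. \<bar>f (Z \<omega>) - g (Z \<omega>)\<bar> \<partial>P)"
        by (rule integral_abs_bound)
      also have "\<dots> \<le> (\<integral>\<omega>. e + 2 * K * indicator ?A \<omega> \<partial>P)"
      proof (rule integral_mono)
        show "integrable P (\<lambda>\<omega>. e + 2 * K * indicator ?A \<omega>)"
          using K by (intro Bochner_Integration.integrable_add integrable_mult_right
              P.integrable_const_bound[of "indicator ?A" 1]) (auto simp: indicator_def)
      qed (use fZ gZ g(2,3) in \<open>auto simp: indicator_def not_less\<close>)
      also have "\<dots> = e + 2 * K * measure P ?A"
        by (subst Bochner_Integration.integral_add)
          (auto simp: P.prob_space intro!: integrable_mult_right P.integrable_const_bound[of _ 1] split: split_indicator)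
      also have "\<dots> \<le> e + 2 * K * d"
        using tail K by simp
      finally show ?thesis .
    qed
    have ed: "e + 2 * K * d = r / 4"
      using K by (simp add: e_def d_def)
    have "(\<lambda>n. \<integral>\<omega>. g (Y n \<omega>) \<partial>M) \<longlonglongrightarrow> (\<integral>x. g x \<partial>N)"
      by (rule integral_trig_poly_tendsto) (fact assms g)+
    then obtain n0 where n0: "\<And>n. n \<ge> n0 \<Longrightarrow> \<bar>(\<integral>\<omega>. g (Y n \<omega>) \<partial>M) - (\<integral>x. g x \<partial>N)\<bar> < r / 4"
      using LIMSEQ_D[of _ _ "r / 4"] \<open>r > 0\<close> by (metis real_norm_def zero_less_divide_iff zero_less_numeral)
    have closeN: "\<bar>(\<integral>x. f x \<partial>N) - (\<integral>x. g x \<partial>N)\<bar> \<le> r / 4"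
      using close[OF N.prob_space_axioms _ RN] unfolding ed by simp
    have "\<bar>(\<integral>\<omega>. f (Y n \<omega>) \<partial>M) - (\<integral>x. f x \<partial>N)\<bar> < r" if "n \<ge> n0" for n
      using close[OF M.prob_space_axioms assms(4) RM, of n] closeN n0[OF that] \<open>r > 0\<close>
      unfolding ed by linarith
    then show "\<exists>n0. \<forall>n\<ge>n0. norm ((\<integral>\<omega>. f (Y n \<omega>) \<partial>M) - (\<integral>x. f x \<partial>N)) < r"
      by auto
  qed
qed

subsection \<open>Gaussian vectors\<close>

definition gauss_vec :: "(real^'n) measure" where
  "gauss_vec = distr (\<Pi>\<^sub>M i\<in>UNIV. std_normal_distribution) borel (\<lambda>f. \<chi> i. f i)"

lemma measurable_vec_lambda [measurable]:
  "(\<lambda>f. \<chi> i. f i) \<in> borel_measurable (\<Pi>\<^sub>M i\<in>(UNIV :: 'n::finite set). std_normal_distribution)"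
proof -
  have "(\<lambda>f :: 'n \<Rightarrow> real. \<chi> i. f i) = (\<lambda>f. \<Sum>i\<in>UNIV. f i *\<^sub>R axis i (1::real))"
    by (auto simp: vec_eq_iff axis_def if_distrib[of "\<lambda>c. _ * c"] cong: if_cong)
  then show ?thesis
    by simp
qed

lemma prob_space_gauss_vec: "prob_space (gauss_vec :: (real^'n) measure)"
proof -
  interpret std: prob_space std_normal_distribution
    by (rule prob_space_normal_density) simp
  show ?thesis
    unfolding gauss_vec_def
    by (intro prob_space.prob_space_distr prob_space_PiM measurable_vec_lambda std.prob_space_axioms)
qed

lemma sets_gauss_vec [simp, measurable_cong]: "sets gauss_vec = sets borel"
  by (simp add: gauss_vec_def)

text \<open>The coordinates are independent, so the integral factors into one-dimensional standard
  normal characteristic functions.\<close>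

lemma char_gauss_vec:
  fixes t :: "real^'n"
  shows "(\<integral>x. cis (t \<bullet> x) \<partial>gauss_vec) = of_real (exp (- (t \<bullet> t) / 2))"
proof -
  interpret std: prob_space std_normal_distribution
    by (rule prob_space_normal_density) simp
  interpret product_sigma_finite "\<lambda>_::'n. std_normal_distribution"
    by unfold_locales
  have "(\<integral>x. cis (t \<bullet> x) \<partial>gauss_vec) =
      (\<integral>f. cis (t \<bullet> (\<chi> i. f i)) \<partial>(\<Pi>\<^sub>M i\<in>UNIV. std_normal_distribution))"
    unfolding gauss_vec_def
    by (rule integral_distr) (auto intro!: borel_measurable_continuous_onI continuous_intros simp: cis_conv_exp)
  also have "\<dots> = (\<integral>f. (\<Prod>i\<in>UNIV. cis (t $ i * f i)) \<partial>(\<Pi>\<^sub>M i\<in>UNIV. std_normal_distribution))"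
    by (simp add: inner_vec_def cis_conv_exp exp_sum sum_distrib_left)
  also have "\<dots> = (\<Prod>i\<in>UNIV. (\<integral>x. cis (t $ i * x) \<partial>std_normal_distribution))"
  proof (rule product_integral_prod)
    show "integrable std_normal_distribution (\<lambda>x. cis (t $ i * x))" for i
      by (rule std.integrable_const_bound[of _ 1]) (auto simp: cis_conv_exp)
  qed simp
  also have "\<dots> = (\<Prod>i\<in>UNIV. of_real (exp (- (t $ i)\<^sup>2 / 2)))"
    using char_std_normal_distribution by (simp add: char_def cis_conv_exp fun_eq_iff)
  also have "\<dots> = of_real (exp (\<Sum>i\<in>UNIV. - (t $ i)\<^sup>2 / 2))"
    by (simp add: exp_sum)
  also have "(\<Sum>i\<in>UNIV. - (t $ i)\<^sup>2 / 2) = - (t \<bullet> t) / 2"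
    by (simp add: inner_vec_def power2_eq_square sum_negf sum_divide_distrib)
  finally show ?thesis .
qed

text \<open>Here \<open>A\<close> is the adjoint of \<open>L\<close>, and \<open>Q\<close> is the
  form of the covariance \<open>L L^T\<close>. Working with the image of a standard normal vector
  admits degenerate covariances, which have no density.\<close>

lemma centered_normal_linear_image:
  fixes L :: "real^'n \<Rightarrow> 'b::euclidean_space"
  assumes [measurable]: "L \<in> borel_measurable borel"
    and adj: "\<And>t x. t \<bullet> L x = A t \<bullet> x" and Q: "\<And>t. Q t = A t \<bullet> A t"
  shows "centered_normal Q (distr gauss_vec borel L)"
  unfolding centered_normal_def
proof (intro conjI allI)
  show "prob_space (distr gauss_vec borel L)"
    by (intro prob_space.prob_space_distr prob_space_gauss_vec) simp
  show "(\<integral>x. cis (t \<bullet> x) \<partial>distr gauss_vec borel L) = of_real (exp (- Q t / 2))" for t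
  proof -
    have "(\<integral>x. cis (t \<bullet> x) \<partial>distr gauss_vec borel L) = (\<integral>x. cis (t \<bullet> L x) \<partial>gauss_vec)"
      by (rule integral_distr) (auto simp: cis_conv_exp)
    then show ?thesis
      by (simp add: adj Q char_gauss_vec)
  qed
qed simp

text \<open>The first block of a standard normal vector is projected orthogonally to \<open>mu\<close>, the second one is
  its component along \<open>mu\<close>, which makes the blocks uncorrelated.\<close>
lemma centered_normal_block_exists:
  fixes mu :: "real^'n" and a b :: real
  assumes mu: "norm mu = 1" and "a \<ge> 0" "b \<ge> 0"
  shows "\<exists>N. centered_normal (\<lambda>(u :: real^'n, s :: real). a * (u \<bullet> u - (u \<bullet> mu)\<^sup>2) + b * s\<^sup>2) N"
proof
  define L :: "real^'n \<Rightarrow> (real^'n) \<times> real"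
    where "L g = (sqrt a *\<^sub>R (g - (g \<bullet> mu) *\<^sub>R mu), sqrt b * (g \<bullet> mu))" for g
  \<comment> \<open>The adjoint of \<open>L\<close>. Its two summands are orthogonal, the first
    being perpendicular to \<open>mu\<close>, so the squared length of \<open>A t\<close> splits
    into the two blocks of the covariance.\<close>
  define A :: "(real^'n) \<times> real \<Rightarrow> real^'n"
    where "A = (\<lambda>(u, s). sqrt a *\<^sub>R (u - (u \<bullet> mu) *\<^sub>R mu) + (sqrt b * s) *\<^sub>R mu)"
  have mu1: "mu \<bullet> mu = 1"
    using mu by (simp add: dot_square_norm)
  show "centered_normal (\<lambda>(u, s). a * (u \<bullet> u - (u \<bullet> mu)\<^sup>2) + b * s\<^sup>2) (distr gauss_vec borel L)"
  proof (rule centered_normal_linear_image)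
    show "L \<in> borel_measurable borel"
      unfolding L_def by (intro borel_measurable_continuous_onI continuous_intros)
    show "t \<bullet> L x = A t \<bullet> x" for t x
      by (cases t) (simp add: L_def A_def inner_add_left inner_diff inner_commute algebra_simps)
    show "(case t of (u, s) \<Rightarrow> a * (u \<bullet> u - (u \<bullet> mu)\<^sup>2) + b * s\<^sup>2) = A t \<bullet> A t" for t
    proof (cases t)
      case (Pair u s)
      have "(r *\<^sub>R (u - (u \<bullet> mu) *\<^sub>R mu) + q *\<^sub>R mu) \<bullet> (r *\<^sub>R (u - (u \<bullet> mu) *\<^sub>R mu) + q *\<^sub>R mu) =
          r\<^sup>2 * (u \<bullet> u - (u \<bullet> mu)\<^sup>2) + q\<^sup>2" for r q :: real
        by (simp add: inner_add inner_diff inner_commute mu1 algebra_simps power2_eq_square)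
      then show ?thesis
        using assms by (simp add: Pair A_def power_mult_distrib)
    qed
  qed
qed

subsection \<open>Moments of the uniform and the cardioid distribution on the sphere\<close>

text \<open>Invariance under signed permutations of the coordinates already determines the first and second
  moments of the uniform law; Lebesgue measure is seen to be invariant by looking at boxes only.\<close>
definition signed_perm :: "('n \<Rightarrow> real) \<Rightarrow> ('n \<Rightarrow> 'n) \<Rightarrow> real^'n \<Rightarrow> real^'n" where
  "signed_perm s p x = (\<chi> i. s i * x $ p i)"

lemma signed_perm_nth [simp]: "signed_perm s p x $ i = s i * x $ p i"
  by (simp add: signed_perm_def)

lemma linear_signed_perm: "linear (signed_perm s p)"
  by (rule linearI) (auto simp: vec_eq_iff algebra_simps)

lemma borel_measurable_signed_perm [measurable]: "signed_perm s p \<in> borel_measurable borel"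
  using linear_signed_perm
  by (intro borel_measurable_continuous_onI linear_continuous_on) (simp add: linear_conv_bounded_linear)

lemma norm_signed_perm:
  fixes x :: "real^'n"
  assumes "bij p" and s: "\<And>i. \<bar>s i\<bar> = 1"
  shows "norm (signed_perm s p x) = norm x"
proof -
  have "(\<Sum>i\<in>UNIV. (s i * x $ p i)\<^sup>2) = (\<Sum>i\<in>UNIV. (x $ p i)\<^sup>2)"
  proof (intro sum.cong refl)
    fix i
    have "(s i)\<^sup>2 = 1" using s[of i] by (metis power2_abs one_power2)
    then show "(s i * x $ p i)\<^sup>2 = (x $ p i)\<^sup>2" by (simp add: power_mult_distrib)
  qed
  also have "\<dots> = (\<Sum>i\<in>UNIV. (x $ i)\<^sup>2)"
    by (rule sum.reindex_bij_betw[OF \<open>bij p\<close>])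
  finally show ?thesis
    by (simp add: norm_vec_def L2_set_def)
qed

lemma sgn_signed_perm:
  fixes x :: "real^'n"
  assumes "bij p" "\<And>i. \<bar>s i\<bar> = 1"
  shows "sgn (signed_perm s p x) = signed_perm s p (sgn x)"
  by (simp add: sgn_div_norm norm_signed_perm[OF assms] linear_cmul[OF linear_signed_perm])

lemma prod_Basis_vec:
  fixes x :: "real^'n"
  shows "(\<Prod>b\<in>Basis. x \<bullet> b) = (\<Prod>i\<in>UNIV. x $ i)"
proof -
  have "bij_betw (\<lambda>i::'n. axis i (1::real)) UNIV Basis"
    by (auto simp: bij_betw_def inj_def axis_eq_axis Basis_vec_def)
  then have "(\<Prod>i\<in>UNIV. x \<bullet> axis i 1) = (\<Prod>b\<in>Basis. x \<bullet> b)"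
    by (rule prod.reindex_bij_betw)
  then show ?thesis
    by (simp add: inner_axis)
qed

lemma lborel_distr_signed_perm:
  assumes "bij p" and s: "\<And>i. \<bar>s i\<bar> = 1"
  shows "distr lborel borel (signed_perm s p) = (lborel :: (real^'n) measure)"
proof (rule lborel_eqI[symmetric])
  fix l u :: "real^'n"
  assume "\<And>b. b \<in> Basis \<Longrightarrow> l \<bullet> b \<le> u \<bullet> b"
  then have lu: "l $ i \<le> u $ i" for i
    by (metis axis_in_Basis_iff cart_eq_inner_axis Basis_real_def insertI1)
  define q where "q = inv p"
  have pq [simp]: "p (q j) = j" "q (p i) = i" for i j
    using \<open>bij p\<close> by (simp_all add: q_def bij_is_surj surj_f_inv_f bij_is_inj)
  have s': "s i = 1 \<or> s i = -1" for i
    using s[of i] by (auto simp: abs_if split: if_splits)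
  \<comment> \<open>The preimage of a box is again a box: side \<open>i\<close> moves to coordinate
    \<open>p i\<close>, and a negative sign reflects the interval from \<open>l\<close> to
    \<open>u\<close> into the one from \<open>- u\<close> to \<open>- l\<close>.\<close>
  define l' u' :: "real^'n"
    where "l' = (\<chi> j. if s (q j) = 1 then l $ q j else - u $ q j)"
      and "u' = (\<chi> j. if s (q j) = 1 then u $ q j else - l $ q j)"
  have "l $ i < s i * x $ p i \<and> s i * x $ p i < u $ i \<longleftrightarrow> l' $ p i < x $ p i \<and> x $ p i < u' $ p i" for x i
    using s'[of i] by (auto simp: l'_def u'_def)
  then have *: "(\<forall>i. l $ i < s i * x $ p i \<and> s i * x $ p i < u $ i) \<longleftrightarrow> (\<forall>j. l' $ j < x $ j \<and> x $ j < u' $ j)" for x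
    by (metis pq(1))
  have "signed_perm s p -` box l u = box l' u'"
    using * by (auto simp: mem_box_cart)
  then have "emeasure (distr lborel borel (signed_perm s p)) (box l u) = emeasure lborel (box l' u')"
    by (simp add: emeasure_distr)
  also have "\<dots> = ennreal (\<Prod>b\<in>Basis. (u' - l') \<bullet> b)"
    using lu by (subst emeasure_lborel_box) (auto simp: Basis_vec_def inner_axis l'_def u'_def)
  also have "(\<Prod>b\<in>Basis. (u' - l') \<bullet> b) = (\<Prod>j\<in>UNIV. (u - l) $ q j)"
    unfolding prod_Basis_vec by (intro prod.cong) (auto simp: l'_def u'_def)
  also have "\<dots> = (\<Prod>i\<in>UNIV. (u - l) $ i)"
    using \<open>bij p\<close> unfolding q_def by (intro prod.reindex_bij_betw) (rule bij_imp_bij_inv)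
  also have "\<dots> = (\<Prod>b\<in>Basis. (u - l) \<bullet> b)"
    by (simp add: prod_Basis_vec)
  finally show "emeasure (distr lborel borel (signed_perm s p)) (box l u) = (\<Prod>b\<in>Basis. (u - l) \<bullet> b)" .
qed simp

text \<open>The cone construction of \<open>sphere_surface\<close>, normalized on the ball before
  projecting, so that a probability measure results.\<close>

definition sphere_unif :: "(real^'n) measure" where
  "sphere_unif = distr (uniform_measure lborel (ball 0 1)) borel sgn"

lemma sets_sphere_unif [simp, measurable_cong]: "sets sphere_unif = sets borel"
  by (simp add: sphere_unif_def)

lemma space_sphere_unif [simp]: "space sphere_unif = UNIV"
  by (simp add: sphere_unif_def)

lemma emeasure_unit_ball:
  "emeasure lborel (ball (0::real^'n) 1) = ennreal (unit_ball_vol CARD('n))"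
  by (simp add: emeasure_ball)

lemma prob_space_sphere_unif: "prob_space (sphere_unif :: (real^'n) measure)"
  unfolding sphere_unif_def
  by (intro prob_space.prob_space_distr prob_space_uniform_measure)
    (auto simp: emeasure_unit_ball simp: ennreal_eq_0_iff not_le)

text \<open>Only the origin fails, because \<open>sgn 0 = 0\<close>, and it is a Lebesgue null
  set.\<close>

lemma AE_sphere_unif: "AE x in (sphere_unif :: (real^'n) measure). norm x = 1"
proof -
  have "AE x in uniform_measure lborel (ball (0::real^'n) 1). norm (sgn x) = 1"
    by (rule AE_uniform_measureI)
      (use AE_lborel_singleton[of "0::real^'n"] in \<open>auto simp: norm_sgn elim: eventually_mono\<close>)
  then show ?thesis
    unfolding sphere_unif_def by (subst AE_distr_iff) auto
qed

text \<open>A signed permutation is a linear isometry: it preserves the ball and commutes with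
  \<open>sgn\<close>, so the invariance is inherited from Lebesgue measure.\<close>

lemma sphere_unif_distr_signed_perm:
  assumes p: "bij p" and s: "\<And>i. \<bar>s i\<bar> = 1"
  shows "distr sphere_unif borel (signed_perm s p) = (sphere_unif :: (real^'n) measure)"
proof (rule measure_eqI)
  fix A :: "(real^'n) set"
  assume "A \<in> sets (distr sphere_unif borel (signed_perm s p))"
  then have [measurable]: "A \<in> sets borel" by simp
  let ?T = "signed_perm s p" and ?B = "ball (0::real^'n) 1"
  have [measurable]: "sgn -` A \<in> sets borel" "?T -` A \<in> sets borel" "sgn -` ?T -` A \<in> sets borel"
    using measurable_sets_borel[of sgn borel A] measurable_sets_borel[of ?T borel A] measurable_sets_borel[of "\<lambda>x. ?T (sgn x)" borel A]
    by (simp_all add: vimage_comp comp_def)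
  have "emeasure (distr sphere_unif borel ?T) A = emeasure (uniform_measure lborel ?B) (sgn -` ?T -` A)"
    by (simp add: sphere_unif_def emeasure_distr)
  also have "\<dots> = emeasure lborel (?B \<inter> sgn -` ?T -` A) / emeasure lborel ?B"
    by simp
  also have "?B \<inter> sgn -` ?T -` A = ?T -` (?B \<inter> sgn -` A)"
    by (auto simp: norm_signed_perm[OF assms] sgn_signed_perm[OF assms])
  also have "emeasure lborel \<dots> = emeasure (distr lborel borel ?T) (?B \<inter> sgn -` A)"
    by (simp add: emeasure_distr)
  also have "\<dots> = emeasure lborel (?B \<inter> sgn -` A)"
    by (simp add: lborel_distr_signed_perm[OF assms])
  also have "\<dots> / emeasure lborel ?B = emeasure sphere_unif A"
    by (simp add: sphere_unif_def emeasure_distr)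
  finally show "emeasure (distr sphere_unif borel ?T) A = emeasure sphere_unif A" .
qed simp

lemma integral_sphere_unif_signed_perm:
  fixes f :: "real^'n \<Rightarrow> real"
  assumes [measurable]: "f \<in> borel_measurable borel" and "bij p" "\<And>i. \<bar>s i\<bar> = 1"
  shows "(\<integral>x. f (signed_perm s p x) \<partial>sphere_unif) = (\<integral>x. f x \<partial>sphere_unif)"
proof -
  have "(\<integral>x. f (signed_perm s p x) \<partial>sphere_unif) = (\<integral>x. f x \<partial>distr sphere_unif borel (signed_perm s p))"
    by (simp add: integral_distr)
  then show ?thesis
    by (simp add: sphere_unif_distr_signed_perm assms(2,3))
qed

text \<open>The measure lives on the whole space but is concentrated on the compact sphere, where a
  continuous function is bounded.\<close>

lemma integrable_sphere_unif:
  fixes f :: "real^'n \<Rightarrow> real"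
  assumes "continuous_on UNIV f"
  shows "integrable sphere_unif f"
proof -
  interpret prob_space "sphere_unif :: (real^'n) measure" by (rule prob_space_sphere_unif)
  have [measurable]: "f \<in> borel_measurable borel"
    using assms by (rule borel_measurable_continuous_onI)
  have "compact (f ` sphere 0 1)"
    using assms by (intro compact_continuous_image) (auto intro: continuous_on_subset)
  then obtain B where "\<And>x. norm x = 1 \<Longrightarrow> \<bar>f x\<bar> \<le> B"
    by (force dest!: compact_imp_bounded simp: bounded_iff)
  then show ?thesis
    using AE_sphere_unif by (intro integrable_const_bound[of _ B]) (auto elim: eventually_mono)
qed

lemma integral_sphere_unif_odd:
  fixes f :: "real^'n \<Rightarrow> real"
  assumes [measurable]: "f \<in> borel_measurable borel" and "\<And>x. f (- x) = - f x"
  shows "(\<integral>x. f x \<partial>sphere_unif) = 0"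
proof -
  \<comment> \<open>The antipodal map is the signed permutation that flips every sign; under it the
    integral equals its own negative.\<close>
  have "signed_perm (\<lambda>_. -1) (\<lambda>i. i) = (uminus :: real^'n \<Rightarrow> real^'n)"
    by (auto simp: vec_eq_iff)
  with integral_sphere_unif_signed_perm[of f "\<lambda>i. i" "\<lambda>_. -1"] show ?thesis
    using assms by (simp add: bij_id[unfolded id_def])
qed

text \<open>Transpositions make all squared coordinates equal in mean, and they sum to 1 on the
  sphere. Flipping the sign of coordinate \<open>i\<close> alone kills the mixed moments.\<close>

lemma integral_sphere_unif_nth_nth:
  "(\<integral>x. x $ i * x $ j \<partial>sphere_unif) = (if i = j then 1 / CARD('n) else 0)" for i j :: "'n::finite"
proof -
  interpret prob_space "sphere_unif :: (real^'n) measure" by (rule prob_space_sphere_unif)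
  have int: "integrable (sphere_unif :: (real^'n) measure) (\<lambda>x. (x $ k)\<^sup>2)" for k
    by (intro integrable_sphere_unif continuous_intros)
  show ?thesis
  proof (cases "i = j")
    case True
    have "(\<integral>x. (x $ k)\<^sup>2 \<partial>sphere_unif) = (\<integral>x. (x $ i)\<^sup>2 \<partial>sphere_unif)" for k :: 'n
      using integral_sphere_unif_signed_perm[of "\<lambda>x. (x $ i)\<^sup>2" "Transposition.transpose i k" "\<lambda>_. 1"]
      by simp
    then have "(\<Sum>k\<in>UNIV. \<integral>x. (x $ k)\<^sup>2 \<partial>(sphere_unif :: (real^'n) measure)) =
        (\<Sum>k\<in>(UNIV :: 'n set). \<integral>x. (x $ i)\<^sup>2 \<partial>sphere_unif)"
      by (intro sum.cong refl)
    then have "CARD('n) * (\<integral>x. (x $ i)\<^sup>2 \<partial>sphere_unif) = (\<Sum>k\<in>UNIV. \<integral>x. (x $ k)\<^sup>2 \<partial>(sphere_unif :: (real^'n) measure))"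
      by simp
    also have "\<dots> = (\<integral>x. (\<Sum>k\<in>UNIV. (x $ k)\<^sup>2) \<partial>(sphere_unif :: (real^'n) measure))"
      using int by simp
    also have "\<dots> = (\<integral>x. 1 \<partial>(sphere_unif :: (real^'n) measure))"
    proof (rule integral_cong_AE)
      have "(\<Sum>k\<in>UNIV. (x $ k)\<^sup>2) = (norm x)\<^sup>2" for x :: "real^'n"
        by (simp add: norm_vec_def L2_set_def sum_nonneg)
      then show "AE x in (sphere_unif :: (real^'n) measure). (\<Sum>k\<in>UNIV. (x $ k)\<^sup>2) = (1::real)"
        using AE_sphere_unif by (auto elim: eventually_mono)
    qed auto
    finally show ?thesis
      using True by (simp add: prob_space[simplified] field_simps power2_eq_square)
  next
    case False
    have "(\<integral>x. - (x $ i * x $ j) \<partial>sphere_unif) = (\<integral>x. x $ i * x $ j \<partial>(sphere_unif :: (real^'n) measure))"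
      using integral_sphere_unif_signed_perm[of "\<lambda>x. x $ i * x $ j" "\<lambda>i. i" "\<lambda>k. if k = i then -1 else 1"] False
      by (simp add: bij_id[unfolded id_def])
    then show ?thesis using False by simp
  qed
qed

lemma integral_sphere_unif_inner_inner:
  fixes v w :: "real^'n"
  shows "(\<integral>x. (v \<bullet> x) * (w \<bullet> x) \<partial>sphere_unif) = (v \<bullet> w) / CARD('n)"
proof -
  have int: "integrable (sphere_unif :: (real^'n) measure) (\<lambda>x. x $ i * x $ j)" for i j
    by (intro integrable_sphere_unif continuous_intros)
  have "(v \<bullet> x) * (w \<bullet> x) = (\<Sum>i\<in>UNIV. \<Sum>j\<in>UNIV. (v $ i * w $ j) * (x $ i * x $ j))" for x
    by (simp add: inner_vec_def sum_product mult_ac)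
  then have "(\<integral>x. (v \<bullet> x) * (w \<bullet> x) \<partial>sphere_unif) =
      (\<Sum>i\<in>UNIV. \<Sum>j\<in>UNIV. (v $ i * w $ j) * (\<integral>x. x $ i * x $ j \<partial>sphere_unif))"
    using int by simp
  also have "\<dots> = (\<Sum>i\<in>UNIV. v $ i * w $ i / CARD('n))"
    by (simp add: integral_sphere_unif_nth_nth if_distrib[of "\<lambda>c. _ * c"] sum.delta cong: if_cong)
  finally show ?thesis
    by (simp add: inner_vec_def sum_divide_distrib)
qed

text \<open>The recursion of \<open>Gamma\<close> at half the dimension relates the area to the ball
  volume, and so matches the normalization of the density with that of the cone measure.\<close>

lemma sphere_area_eq: "sphere_area TYPE('n::finite) = CARD('n) * unit_ball_vol CARD('n)"
proof -
  have *: "Gamma (real CARD('n) / 2 + 1) = real CARD('n) / 2 * Gamma (real CARD('n) / 2)"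
    by (rule Gamma_plus1) (auto dest!: nonpos_Ints_nonpos simp: not_le)
  have "Gamma (real CARD('n) / 2) > 0"
    by (rule Gamma_real_pos) simp
  then show ?thesis
    unfolding sphere_area_def unit_ball_vol_def * by (simp add: divide_simps)
qed

text \<open>The dimension factor of the cone measure cancels against the one in
  \<open>sphere_area\<close>. What remains is division by the volume of the ball, which is the
  normalization in \<open>sphere_unif\<close>.\<close>

lemma C1_dist_eq:
  fixes mu :: "real^'n"
  shows "C1_dist mu rho = density sphere_unif (\<lambda>x. ennreal (1 + rho * (x \<bullet> mu)))"
proof (rule measure_eqI)
  fix A assume "A \<in> sets (C1_dist mu rho)"
  then have [measurable]: "A \<in> sets borel"
    by (simp add: C1_dist_def sphere_surface_def)
  let ?V = "unit_ball_vol CARD('n)" and ?B = "ball (0::real^'n) 1"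
  let ?g = "\<lambda>x. ennreal (1 + rho * (x \<bullet> mu)) * indicator A x"
  have V: "?V > 0" by simp
  have nn: "(\<integral>\<^sup>+x. f x \<partial>sphere_surface) = of_nat CARD('n) * (\<integral>\<^sup>+x. f (sgn x) * indicator ?B x \<partial>lborel)"
    if [measurable]: "f \<in> borel_measurable borel" for f :: "real^'n \<Rightarrow> ennreal"
    unfolding sphere_surface_def
    by (simp add: nn_integral_scale_measure nn_integral_distr)
      (subst nn_integral_density, auto simp: mult.commute intro!: borel_measurable_indicator)
  let ?p = "real CARD('n)"
  have dens: "ennreal ((1 + rho * (x \<bullet> mu)) / sphere_area TYPE('n)) = ennreal (1 / (?p * ?V)) * ennreal (1 + rho * (x \<bullet> mu))" for x
    using V by (subst ennreal_mult'[symmetric]) (simp_all add: sphere_area_eq)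
  have "emeasure (C1_dist mu rho) A = (\<integral>\<^sup>+x. ennreal (1 / (?p * ?V)) * ?g x \<partial>sphere_surface)"
    unfolding C1_dist_def dens
    by (subst emeasure_density) (simp_all add: sphere_surface_def mult.assoc)
  also have "\<dots> = ennreal (1 / (?p * ?V)) * (of_nat CARD('n) * (\<integral>\<^sup>+x. ?g (sgn x) * indicator ?B x \<partial>lborel))"
    by (subst nn_integral_cmult) (simp_all add: nn, simp add: sphere_surface_def)
  also have "\<dots> = ennreal (1 / (?p * ?V) * ?p) * (\<integral>\<^sup>+x. ?g (sgn x) * indicator ?B x \<partial>lborel)"
    using V by (subst ennreal_mult') (simp_all add: ennreal_of_nat_eq_real_of_nat mult.assoc)
  also have "\<dots> = (\<integral>\<^sup>+x. ?g (sgn x) * indicator ?B x \<partial>lborel) / ennreal ?V"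
  proof -
    have "1 / (?p * ?V) * ?p = inverse ?V"
      by (simp add: divide_inverse)
    then show ?thesis
      using V by (simp only: divide_ennreal_def inverse_ennreal mult.commute)
  qed
  also have "\<dots> = (\<integral>\<^sup>+x. ?g x \<partial>sphere_unif)"
    by (simp add: sphere_unif_def nn_integral_distr nn_integral_uniform_measure emeasure_unit_ball)
  also have "\<dots> = emeasure (density sphere_unif (\<lambda>x. ennreal (1 + rho * (x \<bullet> mu)))) A"
    by (simp add: emeasure_density)
  finally show "emeasure (C1_dist mu rho) A = emeasure (density sphere_unif (\<lambda>x. ennreal (1 + rho * (x \<bullet> mu)))) A" .
qed (simp add: C1_dist_def sphere_surface_def)

section \<open>Moments of the cardioid law\<close>

context
  fixes mu :: "real^'n" and rho :: real
  assumes mu: "norm mu = 1" and rho: "0 < rho" "rho < 1"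
begin

lemma integral_C1_dist:
  fixes f :: "real^'n \<Rightarrow> real"
  assumes [measurable]: "f \<in> borel_measurable borel"
  shows "(\<integral>x. f x \<partial>C1_dist mu rho) = (\<integral>x. (1 + rho * (x \<bullet> mu)) * f x \<partial>sphere_unif)"
  unfolding C1_dist_eq
proof (subst integral_density)
  \<comment> \<open>The expression can be negative off the sphere, so its sign is checked only
    almost everywhere, where Cauchy-Schwarz bounds the inner product by 1.\<close>
  show "AE x in sphere_unif. 0 \<le> 1 + rho * (x \<bullet> mu)"
    using AE_sphere_unif
  proof eventually_elim
    case (elim x)
    have "\<bar>rho * (x \<bullet> mu)\<bar> \<le> 1 * 1"
      using Cauchy_Schwarz_ineq2[of x mu] elim mu rho unfolding abs_mult
      by (intro mult_mono) auto
    then show ?case by linarith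
  qed
qed auto

lemma AE_C1_dist: "AE x in C1_dist mu rho. norm x = 1"
  unfolding C1_dist_eq using AE_sphere_unif by (subst AE_density) (auto elim: eventually_mono)

text \<open>The constant part of the density contributes an odd integrand and drops out; the linear
  part contributes a second moment of the uniform law.\<close>

lemma C1_dist_mean: "(\<integral>x. w \<bullet> x \<partial>C1_dist mu rho) = rho / CARD('n) * (w \<bullet> mu)"
proof -
  have "(\<integral>x. w \<bullet> x \<partial>C1_dist mu rho) = (\<integral>x. w \<bullet> x + rho * ((w \<bullet> x) * (mu \<bullet> x)) \<partial>sphere_unif)"
    by (subst integral_C1_dist) (auto simp: algebra_simps inner_commute)
  also have "\<dots> = (\<integral>x. w \<bullet> x \<partial>sphere_unif) + rho * (\<integral>x. (w \<bullet> x) * (mu \<bullet> x) \<partial>sphere_unif)"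
    by (subst Bochner_Integration.integral_add) (auto intro!: integrable_sphere_unif continuous_intros)
  also have "\<dots> = rho / CARD('n) * (w \<bullet> mu)"
    by (simp add: integral_sphere_unif_inner_inner integral_sphere_unif_odd)
  finally show ?thesis .
qed

text \<open>The linear part of the density contributes an odd cubic integrand, so the second moments
  agree with those of the uniform law.\<close>

lemma C1_dist_second_moment: "(\<integral>x. (w \<bullet> x)\<^sup>2 \<partial>C1_dist mu rho) = (w \<bullet> w) / CARD('n)"
proof -
  have "(\<integral>x. (w \<bullet> x)\<^sup>2 \<partial>C1_dist mu rho) = (\<integral>x. (w \<bullet> x) * (w \<bullet> x) + rho * (mu \<bullet> x) * (w \<bullet> x)\<^sup>2 \<partial>sphere_unif)"
    by (subst integral_C1_dist) (auto simp: algebra_simps inner_commute power2_eq_square)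
  also have "\<dots> = (\<integral>x. (w \<bullet> x) * (w \<bullet> x) \<partial>sphere_unif) + (\<integral>x. rho * (mu \<bullet> x) * (w \<bullet> x)\<^sup>2 \<partial>sphere_unif)"
    by (intro Bochner_Integration.integral_add integrable_sphere_unif continuous_intros)
  also have "\<dots> = (w \<bullet> w) / CARD('n)"
    by (simp add: integral_sphere_unif_inner_inner integral_sphere_unif_odd)
  finally show ?thesis .
qed

end

subsection \<open>Limit theorems and linearization\<close>

lemma (in prob_space) strong_law_bounded_iid:
  fixes Y :: "nat \<Rightarrow> 'a \<Rightarrow> real"
  assumes indep: "indep_vars (\<lambda>_. borel) Y UNIV"
    and dist: "\<And>i. distr M borel (Y i) = distr M borel (Y 0)"
    and bound: "AE \<omega> in M. \<bar>Y 0 \<omega>\<bar> \<le> b"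
  shows "AE \<omega> in M. (\<lambda>n. (\<Sum>i<n. Y i \<omega>) / real n) \<longlonglongrightarrow> expectation (Y 0)"
proof -
  have [measurable]: "Y i \<in> borel_measurable M" for i
    using indep unfolding indep_vars_def2 by simp
  have b: "\<bar>b\<bar> + 1 > 0" by simp
  \<comment> \<open>Adding 1 keeps the interval in Hoeffding's inequality nondegenerate even when
    \<open>b\<close> is 0.\<close>
  let ?b = "\<bar>b\<bar> + 1"
  define c where "c = expectation (Y 0)"
  have "AE \<omega> in M. \<forall>\<^sub>F n in sequentially. \<bar>(\<Sum>i<n. Y i \<omega>) / real n - c\<bar> < e" if "e > 0" for e
  proof -
    let ?A = "\<lambda>n. {\<omega> \<in> space M. \<bar>(\<Sum>i<n. Y i \<omega>) / real n - c\<bar> \<ge> e}"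
    \<comment> \<open>Hoeffding's exponent is linear in the sample size, so the tail bound is
      geometric with ratio \<open>q\<close> and hence summable.\<close>
    define q where "q = exp (- 2 * e\<^sup>2 / (?b - - ?b)\<^sup>2)"
    have "0 < q" "q < 1"
      using \<open>e > 0\<close> b by (auto simp: q_def)
    have A: "prob (?A n) \<le> 2 * q ^ n" for n
    proof (cases "n = 0")
      case True
      then show ?thesis using prob_le_1[of "?A n"] by (simp del: prob_le_1)
    next
      case False
      interpret H: Hoeffding_ineq_iid M "{..<n}" Y "Y 0" "- ?b" ?b c
      proof unfold_locales
        show "indep_vars (\<lambda>_. borel) Y {..<n}"
          by (rule indep_vars_subset[OF indep]) simp
        show "AE \<omega> in M. Y 0 \<omega> \<in> {- ?b..?b}"
          using bound by eventually_elim auto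
        show "finite {..<n}" by simp
        show "distr M borel (Y i) = distr M borel (Y 0)" for i by (rule dist)
        show "Y 0 \<in> borel_measurable M" by simp
        show "c \<equiv> expectation (Y 0)" by (simp only: c_def)
      qed
      have "prob (?A n) \<le> 2 * exp (- 2 * real (card {..<n}) * e\<^sup>2 / (?b - - ?b)\<^sup>2)"
        using H.Hoeffding_ineq_abs_ge'[of e] False \<open>e > 0\<close> b by (simp add: lessThan_empty_iff)
      also have "\<dots> = 2 * q ^ n"
        unfolding q_def exp_of_nat_mult[symmetric] by simp
      finally show ?thesis .
    qed
    have "AE \<omega> in M. \<forall>\<^sub>F n in sequentially. \<omega> \<in> space M - ?A n"
    proof (rule borel_cantelli_AE1)
      show "summable (\<lambda>n. prob (?A n))"
        by (rule summable_comparison_test'[of "\<lambda>n. 2 * q ^ n"])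
          (use A \<open>0 < q\<close> \<open>q < 1\<close> in \<open>auto intro!: summable_mult summable_geometric\<close>)
    qed (auto simp: less_top[symmetric])
    then show ?thesis
      by (elim eventually_mono) (auto elim!: eventually_mono)
  qed
  \<comment> \<open>The exceptional null set depends on the tolerance; countably many tolerances
    suffice and leave one null set.\<close>
  then have "AE \<omega> in M. \<forall>k::nat. \<forall>\<^sub>F n in sequentially. \<bar>(\<Sum>i<n. Y i \<omega>) / real n - c\<bar> < 1 / real (Suc k)"
    by (subst AE_all_countable) auto
  then show ?thesis
    unfolding c_def[symmetric]
  proof eventually_elim
    case (elim \<omega>)
    show ?case
    proof (rule tendstoI)
      fix e :: real assume "e > 0"
      then obtain k where "1 / real (Suc k) < e"
        using nat_approx_posE by blast
      then show "\<forall>\<^sub>F n in sequentially. dist ((\<Sum>i<n. Y i \<omega>) / real n) c < e"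
        using elim[THEN spec, of k] by (auto simp: dist_real_def elim!: eventually_mono)
    qed
  qed
qed

text \<open>In the expanded square, the cross terms have expectation zero by independence and
  centring.\<close>

lemma (in prob_space) second_moment_indep_sum:
  fixes Y :: "nat \<Rightarrow> 'a \<Rightarrow> real"
  assumes indep: "indep_vars (\<lambda>_. borel) Y UNIV"
    and sq: "\<And>i. integrable M (\<lambda>\<omega>. (Y i \<omega>)\<^sup>2)"
    and mean: "\<And>i. expectation (Y i) = 0"
  shows "integrable M (\<lambda>\<omega>. (\<Sum>i<n. Y i \<omega>)\<^sup>2)"
    and "expectation (\<lambda>\<omega>. (\<Sum>i<n. Y i \<omega>)\<^sup>2) = (\<Sum>i<n. expectation (\<lambda>\<omega>. (Y i \<omega>)\<^sup>2))"
proof -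
  have [measurable]: "Y i \<in> borel_measurable M" for i
    using indep unfolding indep_vars_def2 by simp
  have Y: "integrable M (Y i)" for i
    by (rule square_integrable_imp_integrable) (auto simp: sq)
  have *: "integrable M (\<lambda>\<omega>. Y i \<omega> * Y j \<omega>)"
    "expectation (\<lambda>\<omega>. Y i \<omega> * Y j \<omega>) = (if i = j then expectation (\<lambda>\<omega>. (Y i \<omega>)\<^sup>2) else 0)" for i j
  proof -
    have "indep_vars (\<lambda>_. borel) Y {i, j}"
      by (rule indep_vars_subset[OF indep]) simp
    from indep_vars_lebesgue_integral[OF _ this] indep_vars_integrable[OF _ this]
    show "integrable M (\<lambda>\<omega>. Y i \<omega> * Y j \<omega>)"
      "expectation (\<lambda>\<omega>. Y i \<omega> * Y j \<omega>) = (if i = j then expectation (\<lambda>\<omega>. (Y i \<omega>)\<^sup>2) else 0)"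
      using Y sq by (cases "i = j"; simp add: mean power2_eq_square)+
  qed
  have sum2: "(\<Sum>i<n. Y i \<omega>)\<^sup>2 = (\<Sum>i<n. \<Sum>j<n. Y i \<omega> * Y j \<omega>)" for \<omega>
    by (simp add: power2_eq_square sum_product)
  show "integrable M (\<lambda>\<omega>. (\<Sum>i<n. Y i \<omega>)\<^sup>2)"
    unfolding sum2 using *(1) by auto
  show "expectation (\<lambda>\<omega>. (\<Sum>i<n. Y i \<omega>)\<^sup>2) = (\<Sum>i<n. expectation (\<lambda>\<omega>. (Y i \<omega>)\<^sup>2))"
    unfolding sum2 using *(1) by (simp add: *(2))
qed

text \<open>Through this Lipschitz bound, an estimate of the mean distance between two random
  variables becomes an estimate for their characteristic functions.\<close>

lemma norm_cis_diff_le: "norm (cis a - cis b) \<le> \<bar>a - b\<bar>"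
proof -
  have "cis a - cis b = cis b * (cis (a - b) - 1)"
    by (simp add: algebra_simps cis_mult)
  then have "norm (cis a - cis b) = norm (cis (a - b) - 1)"
    by (simp add: norm_mult)
  also have "\<dots> \<le> \<bar>a - b\<bar>"
    using iexp_approx1[of "a - b" 0] by (simp add: cis_conv_exp)
  finally show ?thesis .
qed

section \<open>Global quadratic remainder bounds for length and direction\<close>

lemma norm_minus_one_approx:
  fixes mu y :: "'b::real_inner"
  assumes "norm mu = 1"
  shows "\<bar>norm y - 1 - (y - mu) \<bullet> mu\<bar> \<le> (norm (y - mu))\<^sup>2 / 2"
proof -
  have mu: "mu \<bullet> mu = 1" using assms by (simp add: dot_square_norm)
  have "(norm (y - mu))\<^sup>2 = (norm y)\<^sup>2 + 1 - 2 * (y \<bullet> mu)"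
    by (simp add: power2_norm_eq_inner inner_diff inner_commute mu)
  \<comment> \<open>As \<open>mu\<close> is a unit vector, the remainder is
    \<open>norm y - y \<bullet> mu\<close>. It is nonnegative by Cauchy-Schwarz, and this square
    bounds it from above.\<close>
  moreover have "(norm y - 1)\<^sup>2 \<ge> 0" by simp
  ultimately have "norm y - y \<bullet> mu \<le> (norm (y - mu))\<^sup>2 / 2"
    by (simp add: power2_eq_square algebra_simps)
  moreover have "y \<bullet> mu \<le> norm y"
    using norm_cauchy_schwarz[of y mu] assms by simp
  ultimately show ?thesis
    by (simp add: inner_diff_left mu)
qed

text \<open>The convention \<open>sgn 0 = 0\<close> makes the identity hold at the origin too, which
  lets the bounds below hold for every \<open>y\<close>.\<close>

lemma sgn_diff_self: "sgn y - y = (1 - norm y) *\<^sub>R sgn y" for y :: "'b::real_normed_vector"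
proof (cases "y = 0")
  case False
  then have "(1 - norm y) * inverse (norm y) = inverse (norm y) - 1"
    by (simp add: left_diff_distrib)
  then show ?thesis
    by (simp add: sgn_div_norm scaleR_left_diff_distrib)
qed simp

lemma norm_minus_one_le:
  fixes mu y :: "'b::real_normed_vector"
  assumes "norm mu = 1"
  shows "\<bar>norm y - 1\<bar> \<le> norm (y - mu)"
  using norm_triangle_ineq3[of y mu] assms by simp

lemma norm_sgn_diff_le:
  fixes mu y :: "'b::real_normed_vector"
  assumes "norm mu = 1"
  shows "norm (sgn y - mu) \<le> 2 * norm (y - mu)"
proof -
  have "norm (sgn y - y) \<le> \<bar>norm y - 1\<bar>"
    by (simp add: sgn_diff_self norm_sgn abs_minus_commute)
  also note norm_minus_one_le[OF assms]
  finally show ?thesis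
    using norm_triangle_ineq[of "sgn y - y" "y - mu"] by simp
qed

lemma sgn_approx:
  fixes mu y :: "'b::real_inner"
  assumes mu: "norm mu = 1"
  shows "norm (sgn y - mu - ((y - mu) - ((y - mu) \<bullet> mu) *\<^sub>R mu)) \<le> 5 / 2 * (norm (y - mu))\<^sup>2"
proof -
  let ?h = "y - mu"
  have "sgn y - mu - (?h - (?h \<bullet> mu) *\<^sub>R mu) = (sgn y - y) + (?h \<bullet> mu) *\<^sub>R mu"
    by simp
  \<comment> \<open>The first term is a product of two first-order quantities, bounded with constant
    2; the second is the remainder of the norm, with constant 1/2. Together they give 5/2.\<close>
  also have "\<dots> = (1 - norm y) *\<^sub>R (sgn y - mu) - (norm y - 1 - ?h \<bullet> mu) *\<^sub>R mu"
    unfolding sgn_diff_self by (simp add: algebra_simps)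
  also have "norm \<dots> \<le> \<bar>norm y - 1\<bar> * norm (sgn y - mu) + \<bar>norm y - 1 - ?h \<bullet> mu\<bar>"
    using mu by (intro order_trans[OF norm_triangle_ineq4]) (simp add: abs_minus_commute)
  also have "\<dots> \<le> norm ?h * (2 * norm ?h) + (norm ?h)\<^sup>2 / 2"
    using norm_sgn_diff_le[OF mu] norm_minus_one_le[OF mu] norm_minus_one_approx[OF mu]
    by (intro add_mono mult_mono) auto
  finally show ?thesis
    by (simp add: power2_eq_square)
qed

section \<open>Projections and second moments of the sample mean\<close>

locale cardioid_sample = prob_space M for M :: "'a measure" +
  fixes X :: "nat \<Rightarrow> 'a \<Rightarrow> real^'n" and mu :: "real^'n" and rho :: real
  assumes mu: "norm mu = 1" and rho: "0 < rho" "rho < 1"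
    and indep: "indep_vars (\<lambda>_. borel) X UNIV"
    and distr_X: "\<And>i. distr M borel (X i) = C1_dist mu rho"
begin

definition pop_mean :: "real^'n" where "pop_mean = (rho / real CARD('n)) *\<^sub>R mu"

definition dev :: "nat \<Rightarrow> 'a \<Rightarrow> real^'n" where "dev n \<omega> = sample_mean X n \<omega> - pop_mean"

text \<open>The variance of \<open>w \<bullet> X i\<close>, as second moment minus squared
  mean.\<close>

definition cov_form :: "real^'n \<Rightarrow> real" where "cov_form w = (w \<bullet> w) / real CARD('n) - (w \<bullet> pop_mean)\<^sup>2"

definition centred :: "real^'n \<Rightarrow> nat \<Rightarrow> 'a \<Rightarrow> real" where "centred w i \<omega> = w \<bullet> (X i \<omega> - pop_mean)"

lemma card_ge_1: "real CARD('n) \<ge> 1"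
  by (simp add: Suc_leI)

lemma card_pos: "real CARD('n) > 0"
  by simp

lemma mu_inner_mu [simp]: "mu \<bullet> mu = 1"
  using mu by (simp add: dot_square_norm)

lemma measurable_X [measurable]: "X i \<in> borel_measurable M"
  using indep unfolding indep_vars_def2 by simp

lemma measurable_sample_mean [measurable]: "sample_mean X n \<in> borel_measurable M"
  unfolding sample_mean_def by measurable

lemma measurable_dev [measurable]: "dev n \<in> borel_measurable M"
  unfolding dev_def by measurable

lemma measurable_centred [measurable]: "centred w i \<in> borel_measurable M"
  unfolding centred_def by measurable

lemma AE_norm_X: "AE \<omega> in M. norm (X i \<omega>) = 1"
proof -
  have "AE x in distr M borel (X i). norm x = 1"
    unfolding distr_X by (rule AE_C1_dist[OF mu rho])
  then show ?thesis
    by (subst (asm) AE_distr_iff) auto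
qed

lemma integrable_X_inner: "integrable M (\<lambda>\<omega>. w \<bullet> X i \<omega>)"
proof (rule integrable_const_bound[of _ "norm w"])
  show "AE \<omega> in M. norm (w \<bullet> X i \<omega>) \<le> norm w"
    using AE_norm_X[of i] by eventually_elim (metis Cauchy_Schwarz_ineq2 mult.right_neutral real_norm_def)
qed simp

lemma integrable_X_inner_sq: "integrable M (\<lambda>\<omega>. (w \<bullet> X i \<omega>)\<^sup>2)"
proof (rule integrable_const_bound[of _ "(norm w)\<^sup>2"])
  show "AE \<omega> in M. norm ((w \<bullet> X i \<omega>)\<^sup>2) \<le> (norm w)\<^sup>2"
    using AE_norm_X[of i]
    by eventually_elim (use Cauchy_Schwarz_ineq2[of w] in \<open>auto simp: abs_le_square_iff[symmetric]\<close>,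
      metis mult.right_neutral)
qed simp

lemma expectation_X_inner: "expectation (\<lambda>\<omega>. w \<bullet> X i \<omega>) = w \<bullet> pop_mean"
proof -
  have "expectation (\<lambda>\<omega>. w \<bullet> X i \<omega>) = (\<integral>x. w \<bullet> x \<partial>distr M borel (X i))"
    by (simp add: integral_distr)
  then show ?thesis
    by (simp add: distr_X C1_dist_mean[OF mu rho] pop_mean_def)
qed

lemma expectation_X_inner_sq: "expectation (\<lambda>\<omega>. (w \<bullet> X i \<omega>)\<^sup>2) = (w \<bullet> w) / real CARD('n)"
proof -
  have "expectation (\<lambda>\<omega>. (w \<bullet> X i \<omega>)\<^sup>2) = (\<integral>x. (w \<bullet> x)\<^sup>2 \<partial>distr M borel (X i))"
    by (simp add: integral_distr)
  then show ?thesis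
    by (simp add: distr_X C1_dist_second_moment[OF mu rho])
qed

lemma centred_sq: "(centred w i \<omega>)\<^sup>2 = (w \<bullet> X i \<omega>)\<^sup>2 - 2 * (w \<bullet> pop_mean) * (w \<bullet> X i \<omega>) + (w \<bullet> pop_mean)\<^sup>2"
  by (simp add: centred_def inner_diff_right power2_diff)

lemma expectation_centred: "expectation (centred w i) = 0"
  unfolding centred_def inner_diff_right
  by (simp add: integrable_X_inner expectation_X_inner prob_space)

lemma integrable_centred_sq: "integrable M (\<lambda>\<omega>. (centred w i \<omega>)\<^sup>2)"
  unfolding centred_sq by (simp add: integrable_X_inner integrable_X_inner_sq)

lemma expectation_centred_sq: "expectation (\<lambda>\<omega>. (centred w i \<omega>)\<^sup>2) = cov_form w"
  unfolding centred_sq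
  by (simp add: integrable_X_inner integrable_X_inner_sq expectation_X_inner expectation_X_inner_sq
      prob_space) (simp add: cov_form_def power2_eq_square)

lemma indep_centred: "indep_vars (\<lambda>_. borel) (centred w) UNIV"
  unfolding centred_def by (rule indep_vars_compose2[OF indep]) simp

lemma distr_centred: "distr M borel (centred w i) = distr (C1_dist mu rho) borel (\<lambda>x. w \<bullet> (x - pop_mean))"
  unfolding distr_X[of i, symmetric] centred_def by (subst distr_distr) (auto simp: comp_def)

text \<open>The case \<open>n = 0\<close> is excluded: the empty sample mean is 0, so
  \<open>dev 0\<close> is \<open>- pop_mean\<close>, whereas the right-hand side would be 0.\<close>

lemma inner_dev: "w \<bullet> dev n \<omega> = (\<Sum>i<n. centred w i \<omega>) / n" if "n > 0"
  using that by (simp add: dev_def sample_mean_def centred_def inner_diff_right inner_sum_right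
      sum_subtractf field_simps)

text \<open>Each coordinate of the sample mean has variance at most \<open>1 / CARD('n)\<close>
  divided by \<open>n\<close>; summing over the \<open>CARD('n)\<close> coordinates gives
  \<open>1 / n\<close>.\<close>

lemma dev_second_moment:
  assumes "n > 0"
  shows "integrable M (\<lambda>\<omega>. (norm (dev n \<omega>))\<^sup>2)" "expectation (\<lambda>\<omega>. (norm (dev n \<omega>))\<^sup>2) \<le> 1 / n"
proof -
  have eq: "(norm (dev n \<omega>))\<^sup>2 = (\<Sum>b\<in>Basis. (\<Sum>i<n. centred b i \<omega>)\<^sup>2 / (real n)\<^sup>2)" for \<omega>
    unfolding power2_norm_eq_inner
    by (subst euclidean_inner) (simp add: inner_dev[OF assms] inner_commute power_divide flip: power2_eq_square)
  note centred = second_moment_indep_sum[OF indep_centred integrable_centred_sq expectation_centred]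
  show "integrable M (\<lambda>\<omega>. (norm (dev n \<omega>))\<^sup>2)"
    unfolding eq using centred(1) by simp
  have "expectation (\<lambda>\<omega>. (norm (dev n \<omega>))\<^sup>2) = (\<Sum>b\<in>Basis. cov_form b / n)"
    unfolding eq using centred assms by (simp add: expectation_centred_sq) (simp add: power2_eq_square)
  also have "\<dots> \<le> (\<Sum>b\<in>(Basis :: (real^'n) set). 1 / real CARD('n) / n)"
    by (intro sum_mono divide_right_mono) (auto simp: cov_form_def)
  also have "\<dots> = 1 / n"
    by simp
  finally show "expectation (\<lambda>\<omega>. (norm (dev n \<omega>))\<^sup>2) \<le> 1 / n" .
qed

section \<open>Strong law for the sample mean and consistency\<close>

lemma sample_mean_strong_law: "AE \<omega> in M. (\<lambda>n. sample_mean X n \<omega>) \<longlonglongrightarrow> pop_mean"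
proof -
  have "AE \<omega> in M. (\<lambda>n. (\<Sum>i<n. b \<bullet> X i \<omega>) / real n) \<longlonglongrightarrow> b \<bullet> pop_mean" if "b \<in> Basis" for b
  proof -
    have "AE \<omega> in M. (\<lambda>n. (\<Sum>i<n. b \<bullet> X i \<omega>) / real n) \<longlonglongrightarrow> expectation (\<lambda>\<omega>. b \<bullet> X 0 \<omega>)"
    proof (rule strong_law_bounded_iid)
      show "indep_vars (\<lambda>_. borel) (\<lambda>i \<omega>. b \<bullet> X i \<omega>) UNIV"
        by (rule indep_vars_compose2[OF indep]) simp
      have "distr M borel (\<lambda>\<omega>. b \<bullet> X i \<omega>) = distr (C1_dist mu rho) borel (\<lambda>x. b \<bullet> x)" for i
        unfolding distr_X[of i, symmetric] by (subst distr_distr) (auto simp: comp_def)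
      then show "distr M borel (\<lambda>\<omega>. b \<bullet> X i \<omega>) = distr M borel (\<lambda>\<omega>. b \<bullet> X 0 \<omega>)" for i
        by simp
      show "AE \<omega> in M. \<bar>b \<bullet> X 0 \<omega>\<bar> \<le> 1"
        using AE_norm_X[of 0] by eventually_elim (metis Basis_le_norm inner_commute that)
    qed
    then show ?thesis by (simp add: expectation_X_inner)
  qed
  then have "AE \<omega> in M. \<forall>b\<in>Basis. (\<lambda>n. (\<Sum>i<n. b \<bullet> X i \<omega>) / real n) \<longlonglongrightarrow> b \<bullet> pop_mean"
    by (intro AE_finite_allI) auto
  then show ?thesis
  proof eventually_elim
    case (elim \<omega>)
    have "(\<lambda>n. \<Sum>b\<in>Basis. ((\<Sum>i<n. b \<bullet> X i \<omega>) / real n) *\<^sub>R b) \<longlonglongrightarrow> (\<Sum>b\<in>Basis. (b \<bullet> pop_mean) *\<^sub>R b)"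
      using elim by (intro tendsto_sum tendsto_scaleR tendsto_const) blast
    moreover have "(\<Sum>b\<in>Basis. ((\<Sum>i<n. b \<bullet> X i \<omega>) / real n) *\<^sub>R b) = sample_mean X n \<omega>" for n
    proof -
      have "(\<Sum>i<n. b \<bullet> X i \<omega>) / real n = sample_mean X n \<omega> \<bullet> b" for b
        unfolding sample_mean_def inner_commute[of b] by (simp add: inner_sum_left)
      then show ?thesis by (simp only: euclidean_representation)
    qed
    moreover have "(\<Sum>b\<in>Basis. (b \<bullet> pop_mean) *\<^sub>R b) = pop_mean"
      by (simp only: inner_commute[of _ pop_mean] euclidean_representation)
    ultimately show ?case by (simp only:)
  qed
qed

lemma mu_hat_eq: "mu_hat_MM1 X n \<omega> = sgn (sample_mean X n \<omega>)"
  by (simp add: mu_hat_MM1_def sgn_div_norm divide_inverse)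

text \<open>Continuous mapping: \<open>sgn\<close> is continuous away from 0, and
  \<open>pop_mean\<close> is nonzero because \<open>rho\<close> is positive.\<close>

lemma estimators_strongly_consistent:
  "AE \<omega> in M. (\<lambda>n. mu_hat_MM1 X n \<omega>) \<longlonglongrightarrow> mu \<and> (\<lambda>n. rho_hat_MM1 X n \<omega>) \<longlonglongrightarrow> rho"
  using sample_mean_strong_law
proof eventually_elim
  case (elim \<omega>)
  have "pop_mean \<noteq> 0" using mu rho by (auto simp: pop_mean_def)
  have "sgn pop_mean = mu" "real CARD('n) * norm pop_mean = rho"
    using mu rho by (simp_all add: pop_mean_def sgn_div_norm)
  then show ?case
    using tendsto_sgn[OF elim \<open>pop_mean \<noteq> 0\<close>] tendsto_mult_left[OF tendsto_norm[OF elim], of "real CARD('n)"]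
    by (simp add: mu_hat_eq rho_hat_MM1_def)
qed

section \<open>Central limit theorem for projections and the delta method\<close>

lemma cov_form_pos:
  assumes "w \<noteq> 0"
  shows "cov_form w > 0"
proof -
  have "(w \<bullet> pop_mean)\<^sup>2 = (rho / real CARD('n))\<^sup>2 * (w \<bullet> mu)\<^sup>2"
    by (simp add: pop_mean_def power_mult_distrib power_divide)
  also have "\<dots> \<le> (rho / real CARD('n))\<^sup>2 * (w \<bullet> w)"
    using Cauchy_Schwarz_ineq[of w mu] by (intro mult_left_mono) auto
  \<comment> \<open>Strictness comes from \<open>rho\<^sup>2 < 1 \<le> CARD('n)\<close>. The central
    limit theorem requires this positive variance.\<close>
  also have "\<dots> < 1 / real CARD('n) * (w \<bullet> w)"
  proof (rule mult_strict_right_mono)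
    have "rho\<^sup>2 < 1" using rho by (simp add: power_less_one_iff)
    also have "1 \<le> real CARD('n)" by (rule card_ge_1)
    finally show "(rho / real CARD('n))\<^sup>2 < 1 / real CARD('n)"
      by (simp add: power2_eq_square field_simps)
  qed (use assms in simp)
  finally show ?thesis by (simp add: cov_form_def)
qed

text \<open>A fixed direction reduces the claim to the scalar central limit theorem, as in the
  Cramer-Wold device. Direction 0 is treated apart because its variance vanishes.\<close>

lemma char_dev_tendsto:
  "(\<lambda>n. expectation (\<lambda>\<omega>. cis (sqrt (real n) * (w \<bullet> dev n \<omega>)))) \<longlonglongrightarrow> of_real (exp (- cov_form w / 2))"
proof (cases "w = 0")
  case True
  then show ?thesis by (simp add: cov_form_def prob_space)
next
  case False
  \<comment> \<open>The standard deviation of the projection. The sums \<open>?S\<close> are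
    normalized by it, and evaluating their characteristic function at \<open>s\<close> undoes
    this.\<close>
  define s where "s = sqrt (cov_form w)"
  have s: "s > 0" "s\<^sup>2 = cov_form w"
    using cov_form_pos[OF False] by (simp_all add: s_def)
  let ?S = "\<lambda>n \<omega>. (\<Sum>i<n. centred w i \<omega>) / sqrt (real n * s\<^sup>2)"
  have "weak_conv_m (\<lambda>n. distr M borel (?S n)) std_normal_distribution"
    using s by (intro central_limit_theorem_zero_mean[OF indep_centred])
      (auto simp: expectation_centred integrable_centred_sq expectation_centred_sq distr_centred)
  then have "(\<lambda>n. char (distr M borel (?S n)) s) \<longlonglongrightarrow> char std_normal_distribution s"
    by (intro levy_continuity1 real_dist_normal_dist) (auto intro!: real_distribution_distr)
  moreover have "char (distr M borel (?S n)) s = expectation (\<lambda>\<omega>. cis (sqrt (real n) * (w \<bullet> dev n \<omega>)))" for n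
  proof -
    \<comment> \<open>For \<open>n = 0\<close> both sides are 0, since the sum is empty and
      \<open>sqrt 0 = 0\<close>.\<close>
    have "s * ?S n \<omega> = sqrt (real n) * (w \<bullet> dev n \<omega>)" for \<omega>
    proof (cases "n = 0")
      case False
      have "s * ?S n \<omega> = (\<Sum>i<n. centred w i \<omega>) / sqrt (real n)"
        using s(1) by (simp add: real_sqrt_mult)
      also have "\<dots> = (real n / sqrt (real n)) * ((\<Sum>i<n. centred w i \<omega>) / real n)"
        using False by simp
      also have "\<dots> = sqrt (real n) * (w \<bullet> dev n \<omega>)"
        using False by (simp only: real_div_sqrt of_nat_0_le_iff inner_dev neq0_conv)
      finally show ?thesis .
    qed simp
    then show ?thesis
      unfolding char_def by (subst integral_distr) (simp_all add: cis_conv_exp)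
  qed
  ultimately show ?thesis
    using s by (simp add: char_std_normal_distribution)
qed

text \<open>The derivative at \<open>pop_mean\<close> of the map taking \<open>m\<close> to
  \<open>(sgn m, CARD('n) * norm m)\<close>; the factor \<open>CARD('n) / rho\<close> is the
  reciprocal of the length of \<open>pop_mean\<close>.\<close>

definition delta_map :: "real^'n \<Rightarrow> (real^'n) \<times> real" where
  "delta_map h = ((real CARD('n) / rho) *\<^sub>R (h - (h \<bullet> mu) *\<^sub>R mu), real CARD('n) * (h \<bullet> mu))"

definition scaled_error :: "nat \<Rightarrow> 'a \<Rightarrow> (real^'n) \<times> real" where
  "scaled_error n \<omega> = (sqrt (real n) *\<^sub>R (mu_hat_MM1 X n \<omega> - mu), sqrt (real n) * (rho_hat_MM1 X n \<omega> - rho))"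

lemma measurable_scaled_error [measurable]: "scaled_error n \<in> borel_measurable M"
proof -
  have [measurable]: "mu_hat_MM1 X n \<in> borel_measurable M" "rho_hat_MM1 X n \<in> borel_measurable M"
    unfolding mu_hat_MM1_def rho_hat_MM1_def by measurable
  show ?thesis unfolding scaled_error_def by measurable
qed

lemma rescaled_mean:
  fixes n \<omega>
  defines "y \<equiv> (real CARD('n) / rho) *\<^sub>R sample_mean X n \<omega>"
  shows "y - mu = (real CARD('n) / rho) *\<^sub>R dev n \<omega>" "mu_hat_MM1 X n \<omega> = sgn y" "rho_hat_MM1 X n \<omega> = rho * norm y"
  using rho card_pos by (simp_all add: y_def dev_def pop_mean_def scaleR_diff_right mu_hat_eq sgn_scaleR rho_hat_MM1_def)

text \<open>A first-order bound for tightness: the direction contributes the constant 2, and the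
  length contributes \<open>rho\<close>, which is below 1.\<close>

lemma norm_scaled_error_le: "norm (scaled_error n \<omega>) \<le> 3 * (real CARD('n) / rho) * (sqrt n * norm (dev n \<omega>))"
proof -
  define y where "y = (real CARD('n) / rho) *\<^sub>R sample_mean X n \<omega>"
  note y = rescaled_mean[of n \<omega>, folded y_def]
  have "norm (scaled_error n \<omega>) \<le> sqrt n * norm (sgn y - mu) + sqrt n * \<bar>rho * norm y - rho\<bar>"
    unfolding scaled_error_def y by (rule order_trans[OF norm_Pair_le]) (simp add: abs_mult)
  also have "\<bar>rho * norm y - rho\<bar> = rho * \<bar>norm y - 1\<bar>"
  proof -
    have "rho * norm y - rho = rho * (norm y - 1)" by (simp add: algebra_simps)
    then show ?thesis using rho by (simp add: abs_mult)
  qed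
  also have "\<dots> \<le> 1 * norm (y - mu)"
    using rho norm_minus_one_le[OF mu, of y] by (intro mult_mono) auto
  also note norm_sgn_diff_le[OF mu]
  finally have "norm (scaled_error n \<omega>) \<le> 3 * (sqrt n * norm (y - mu))"
    by (simp add: mult_left_mono)
  also have "norm (y - mu) = real CARD('n) / rho * norm (dev n \<omega>)"
    using rho by (simp add: y)
  finally show ?thesis by (simp add: mult_ac)
qed

text \<open>The remainders of direction and length have constants 5/2 and \<open>rho / 2\<close>, at
  most 3 in total. The second moment of \<open>dev\<close> is at most \<open>1 / n\<close>, so the
  mean error is of order \<open>1 / sqrt n\<close>.\<close>

lemma scaled_error_linear_approx:
  "norm (scaled_error n \<omega> - sqrt n *\<^sub>R delta_map (dev n \<omega>)) \<le> 3 * (real CARD('n) / rho)\<^sup>2 * sqrt n * (norm (dev n \<omega>))\<^sup>2"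
proof -
  define y where "y = (real CARD('n) / rho) *\<^sub>R sample_mean X n \<omega>"
  note y = rescaled_mean[of n \<omega>, folded y_def]
  let ?h = "y - mu"
  have dev: "dev n \<omega> = (rho / real CARD('n)) *\<^sub>R ?h"
    using rho by (simp add: y)
  have delta_map: "delta_map (dev n \<omega>) = (?h - (?h \<bullet> mu) *\<^sub>R mu, rho * (?h \<bullet> mu))"
  proof -
    have "delta_map ((rho / real CARD('n)) *\<^sub>R h) = (h - (h \<bullet> mu) *\<^sub>R mu, rho * (h \<bullet> mu))" for h
      using rho by (simp add: delta_map_def scaleR_diff_right)
    then show ?thesis unfolding dev by blast
  qed
  have "scaled_error n \<omega> - sqrt n *\<^sub>R delta_map (dev n \<omega>) =
      sqrt n *\<^sub>R (sgn y - mu - (?h - (?h \<bullet> mu) *\<^sub>R mu), rho * (norm y - 1 - ?h \<bullet> mu))"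
    unfolding delta_map scaled_error_def y(2,3) by (simp add: algebra_simps)
  also have "norm \<dots> \<le> sqrt n * (norm (sgn y - mu - (?h - (?h \<bullet> mu) *\<^sub>R mu)) + \<bar>rho * (norm y - 1 - ?h \<bullet> mu)\<bar>)"
    unfolding norm_scaleR by (intro mult_mono order_trans[OF norm_Pair_le]) auto
  also have "\<bar>rho * (norm y - 1 - ?h \<bullet> mu)\<bar> \<le> 1 * ((norm ?h)\<^sup>2 / 2)"
    unfolding abs_mult using rho norm_minus_one_approx[OF mu] by (intro mult_mono) auto
  also note sgn_approx[OF mu]
  finally have "norm (scaled_error n \<omega> - sqrt n *\<^sub>R delta_map (dev n \<omega>)) \<le> sqrt n * (3 * (norm ?h)\<^sup>2)"
    by (simp add: mult_left_mono)
  also have "norm ?h = real CARD('n) / rho * norm (dev n \<omega>)"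
    using rho by (simp add: y)
  finally show ?thesis by (simp add: power_mult_distrib power_divide mult_ac)
qed

lemma scaled_error_tight:
  assumes "e > 0"
  shows "\<exists>R. \<forall>n. prob {\<omega> \<in> space M. R < norm (scaled_error n \<omega>)} \<le> e"
proof -
  define C where "C = 3 * (real CARD('n) / rho)"
  \<comment> \<open>Chosen so that \<open>C\<^sup>2 / R\<^sup>2 = e\<close>, which is the bound that
    Markov's inequality gives for the squared deviation, uniformly in \<open>n\<close>.\<close>
  define R where "R = C / sqrt e"
  have "C > 0" "R > 0" using rho assms by (auto simp: C_def R_def)
  have "prob {\<omega> \<in> space M. R < norm (scaled_error n \<omega>)} \<le> e" for n
  proof (cases "n = 0")
    case True
    then show ?thesis using \<open>R > 0\<close> assms by (simp add: scaled_error_def)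
  next
    case False
    have "{\<omega> \<in> space M. R < norm (scaled_error n \<omega>)} \<subseteq> {\<omega> \<in> space M. (norm (dev n \<omega>))\<^sup>2 \<ge> R\<^sup>2 / (C\<^sup>2 * n)}"
    proof safe
      fix \<omega> assume "R < norm (scaled_error n \<omega>)"
      also have "\<dots> \<le> C * (sqrt n * norm (dev n \<omega>))"
        unfolding C_def by (rule norm_scaled_error_le)
      finally have "R\<^sup>2 \<le> (C * (sqrt n * norm (dev n \<omega>)))\<^sup>2"
        using \<open>R > 0\<close> by (intro power_mono) auto
      then show "R\<^sup>2 / (C\<^sup>2 * n) \<le> (norm (dev n \<omega>))\<^sup>2"
        using False \<open>C > 0\<close> by (simp add: power_mult_distrib field_simps)
    qed
    then have "prob {\<omega> \<in> space M. R < norm (scaled_error n \<omega>)} \<le>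
        prob {\<omega> \<in> space M. (norm (dev n \<omega>))\<^sup>2 \<ge> R\<^sup>2 / (C\<^sup>2 * n)}"
      by (intro finite_measure_mono) auto
    also have "\<dots> \<le> expectation (\<lambda>\<omega>. (norm (dev n \<omega>))\<^sup>2) / (R\<^sup>2 / (C\<^sup>2 * n))"
      using False \<open>R > 0\<close> \<open>C > 0\<close> dev_second_moment[of n]
      by (intro integral_Markov_inequality_measure[where A = "{}"]) auto
    also have "\<dots> \<le> (1 / n) / (R\<^sup>2 / (C\<^sup>2 * n))"
      using False dev_second_moment[of n] by (intro divide_right_mono) auto
    also have "\<dots> = e"
      using False \<open>C > 0\<close> assms by (simp add: R_def power_divide)
    finally show ?thesis .
  qed
  then show ?thesis by blast
qed

lemma char_scaled_error_tendsto:
  "(\<lambda>n. expectation (\<lambda>\<omega>. cis ((u, s) \<bullet> scaled_error n \<omega>))) \<longlonglongrightarrow>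
    of_real (exp (- (real CARD('n) / rho\<^sup>2 * (u \<bullet> u - (u \<bullet> mu)\<^sup>2) + (real CARD('n) - rho\<^sup>2) * s\<^sup>2) / 2))"
proof -
  \<comment> \<open>The adjoint of \<open>delta_map\<close> applied to \<open>(u, s)\<close>: the
    projected linearized error becomes a projection of \<open>dev\<close> in the direction
    \<open>w\<close>.\<close>
  define w where "w = (real CARD('n) / rho) *\<^sub>R (u - (u \<bullet> mu) *\<^sub>R mu) + (real CARD('n) * s) *\<^sub>R mu"
  have w: "(u, s) \<bullet> delta_map h = w \<bullet> h" for h
    by (simp add: delta_map_def w_def inner_add inner_diff inner_commute algebra_simps)
  have "w \<bullet> w = (real CARD('n) / rho)\<^sup>2 * (u \<bullet> u - (u \<bullet> mu)\<^sup>2) + (real CARD('n) * s)\<^sup>2"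
  proof -
    have "(r *\<^sub>R (u - (u \<bullet> mu) *\<^sub>R mu) + c *\<^sub>R mu) \<bullet> (r *\<^sub>R (u - (u \<bullet> mu) *\<^sub>R mu) + c *\<^sub>R mu) =
          r\<^sup>2 * (u \<bullet> u - (u \<bullet> mu)\<^sup>2) + c\<^sup>2" for r c :: real
        by (simp add: inner_add inner_diff inner_commute algebra_simps power2_eq_square)
    then show ?thesis unfolding w_def by blast
  qed
  \<comment> \<open>The part of \<open>w\<close> orthogonal to \<open>mu\<close> does not see the
    mean, so subtracting the squared mean affects only the second block and produces the
    \<open>- rho\<^sup>2\<close> in its variance.\<close>
  moreover have "w \<bullet> pop_mean = rho * s"
    by (simp add: w_def pop_mean_def inner_add inner_diff)
  ultimately have cov_form: "cov_form w = real CARD('n) / rho\<^sup>2 * (u \<bullet> u - (u \<bullet> mu)\<^sup>2) + (real CARD('n) - rho\<^sup>2) * s\<^sup>2"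
    using card_pos rho by (simp add: cov_form_def power2_eq_square field_simps)
  let ?a = "\<lambda>n \<omega>. (u, s) \<bullet> scaled_error n \<omega>" and ?b = "\<lambda>n \<omega>. sqrt (real n) * (w \<bullet> dev n \<omega>)"
  let ?C = "norm (u, s) * (3 * (real CARD('n) / rho)\<^sup>2)"
  have bound: "norm (expectation (\<lambda>\<omega>. cis (?a n \<omega>)) - expectation (\<lambda>\<omega>. cis (?b n \<omega>))) \<le> ?C / sqrt n"
    if "n > 0" for n
  proof -
    have int: "integrable M (\<lambda>\<omega>. cis (f \<omega>))" if [measurable]: "f \<in> borel_measurable M" for f
      by (rule integrable_const_bound[of _ 1]) (auto simp: cis_conv_exp)
    have "norm (expectation (\<lambda>\<omega>. cis (?a n \<omega>)) - expectation (\<lambda>\<omega>. cis (?b n \<omega>))) =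
        norm (expectation (\<lambda>\<omega>. cis (?a n \<omega>) - cis (?b n \<omega>)))"
      by (simp add: int)
    also have "\<dots> \<le> expectation (\<lambda>\<omega>. ?C * sqrt n * (norm (dev n \<omega>))\<^sup>2)"
    proof (rule order_trans[OF integral_norm_bound integral_mono])
      fix \<omega>
      have "?a n \<omega> - ?b n \<omega> = (u, s) \<bullet> (scaled_error n \<omega> - sqrt n *\<^sub>R delta_map (dev n \<omega>))"
        by (simp add: inner_diff_right w)
      then have "norm (cis (?a n \<omega>) - cis (?b n \<omega>)) \<le> \<bar>(u, s) \<bullet> (scaled_error n \<omega> - sqrt n *\<^sub>R delta_map (dev n \<omega>))\<bar>"
        using norm_cis_diff_le by metis
      also have "\<dots> \<le> norm (u, s) * norm (scaled_error n \<omega> - sqrt n *\<^sub>R delta_map (dev n \<omega>))"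
        by (rule Cauchy_Schwarz_ineq2)
      also have "\<dots> \<le> norm (u, s) * (3 * (real CARD('n) / rho)\<^sup>2 * sqrt n * (norm (dev n \<omega>))\<^sup>2)"
        by (intro mult_left_mono scaled_error_linear_approx) simp
      finally show "norm (cis (?a n \<omega>) - cis (?b n \<omega>)) \<le> ?C * sqrt n * (norm (dev n \<omega>))\<^sup>2"
        by (simp only: mult.assoc)
    qed (use dev_second_moment[OF that] in \<open>auto intro!: int Bochner_Integration.integrable_diff\<close>)
    \<comment> \<open>The factor \<open>sqrt n\<close> of the rescaling meets the second moment
      \<open>1 / n\<close>, leaving a vanishing bound.\<close>
    also have "\<dots> \<le> ?C * sqrt n * (1 / n)"
      unfolding integral_mult_right_zero using dev_second_moment(2)[OF that]
      by (intro mult_left_mono) auto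
    also have "\<dots> = ?C * (sqrt n * (1 / n))"
      by (simp only: mult.assoc)
    also have "sqrt n * (1 / n) = 1 / sqrt n"
      using that by (simp add: field_simps)
    also have "?C * (1 / sqrt n) = ?C / sqrt n"
      by simp
    finally show ?thesis .
  qed
  have "(\<lambda>n. expectation (\<lambda>\<omega>. cis (?a n \<omega>)) - expectation (\<lambda>\<omega>. cis (?b n \<omega>))) \<longlonglongrightarrow> 0"
  proof (rule Lim_null_comparison[where g = "\<lambda>n. ?C / sqrt (real n)"])
    show "(\<lambda>n. ?C / sqrt (real n)) \<longlonglongrightarrow> 0"
      by (rule tendsto_divide_0[OF tendsto_const filterlim_at_top_imp_at_infinity[OF
            filterlim_compose[OF sqrt_at_top filterlim_real_sequentially]]])
  qed (use bound in \<open>auto intro: eventually_sequentiallyI[of 1]\<close>)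
  from tendsto_add[OF this char_dev_tendsto[of w]] show ?thesis
    by (simp add: cov_form)
qed

lemma estimators_asymptotically_normal:
  assumes "centered_normal (\<lambda>(u, s). real CARD('n) / rho\<^sup>2 * (u \<bullet> u - (u \<bullet> mu)\<^sup>2) + (real CARD('n) - rho\<^sup>2) * s\<^sup>2) N"
  shows "conv_in_distr M scaled_error N"
proof (rule conv_in_distr_charI)
  show "(\<lambda>n. expectation (\<lambda>\<omega>. cis (t \<bullet> scaled_error n \<omega>))) \<longlonglongrightarrow> (\<integral>x. cis (t \<bullet> x) \<partial>N)" for t
  proof (cases t)
    case (Pair u s)
    have "(\<integral>x. cis (t \<bullet> x) \<partial>N) =
        of_real (exp (- (real CARD('n) / rho\<^sup>2 * (u \<bullet> u - (u \<bullet> mu)\<^sup>2) + (real CARD('n) - rho\<^sup>2) * s\<^sup>2) / 2))"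
      using assms unfolding centered_normal_def Pair by (simp only: prod.case)
    then show ?thesis
      using char_scaled_error_tendsto[of u s] by (simp only: Pair)
  qed
qed (use assms scaled_error_tight in \<open>auto simp: centered_normal_def prob_space_axioms\<close>)

end

theorem theorem2:
  fixes M :: "'a measure" and X :: "nat \<Rightarrow> 'a \<Rightarrow> real^'n"
    and mu :: "real^'n" and rho :: real
  assumes "prob_space M"
    and "CARD('n) \<ge> 2"
    and "mu \<in> sphere 0 1"
    and "0 < rho" and "rho < 1"
    and "prob_space.indep_vars M (\<lambda>_. borel) X UNIV"
    and "\<And>i. distr M borel (X i) = C1_dist mu rho"
  shows "(AE \<omega> in M. (\<lambda>n. mu_hat_MM1 X n \<omega>) \<longlonglongrightarrow> mu \<and> (\<lambda>n. rho_hat_MM1 X n \<omega>) \<longlonglongrightarrow> rho)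
    \<and> (\<exists>N. centered_normal
              (\<lambda>(u :: real^'n, s :: real).
                  (real CARD('n) / rho^2) * (u \<bullet> u - (u \<bullet> mu)^2)
                + (real CARD('n) - rho^2) * s^2) N
           \<and> conv_in_distr M
              (\<lambda>n \<omega>. (sqrt (real n) *\<^sub>R (mu_hat_MM1 X n \<omega> - mu),
                      sqrt (real n) * (rho_hat_MM1 X n \<omega> - rho))) N)"
proof -
  interpret prob_space M by fact
  interpret cardioid_sample M X mu rho
    by unfold_locales (use assms in auto)
  \<comment> \<open>Both block variances must be nonnegative for the limiting normal law to be
    constructed.\<close>
  have "rho\<^sup>2 \<le> real CARD('n)"
    using assms card_ge_1 power_le_one[of rho 2] by linarith
  then obtain N where N: "centered_normal (\<lambda>(u :: real^'n, s :: real).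
      (real CARD('n) / rho^2) * (u \<bullet> u - (u \<bullet> mu)^2) + (real CARD('n) - rho^2) * s^2) N"
    using centered_normal_block_exists[OF mu, of "real CARD('n) / rho^2" "real CARD('n) - rho^2"] by auto
  with estimators_strongly_consistent estimators_asymptotically_normal[OF N] show ?thesis
    unfolding scaled_error_def by blast
qed

end
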